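(* The block diagonal operator $$\begin{pmatrix} A^{-1} & 0 \\ 0 & M_v^{-1} \end{pmatrix}$$ is a uniform preconditioner for the regularized Maxwell operator $$\begin{pmatrix} A & B^T \\ B & O \end{pmatrix}:\ \boldsymbol U_h\times S_h\to\boldsymbol U_h'\times S_h',$$ i.e. the preconditioned operator and its inverse are bounded by constants independent of $h$ in the product norm $\|\boldsymbol u\|_A+\|p\|_{M_v}$ (so that the preconditioned system has condition number bounded independently of $h$).
   Context: Setting. $\Omega\subset\mathbb R^3$ is a bounded convex polyhedron homeomorphic to a ball, $(\cdot,\cdot)$ is the $L^2(\Omega)$ inner product, and $\mathcal T_h$ is a mesh of size $h$ from a shape-regular quasi-uniform family. $S_h\subset H^1_0$ (Lagrange elements), $\boldsymbol U_h\subset\boldsymbol H_0(\mathrm{curl})$ (edge elements), $\boldsymbol V_h\subset\boldsymbol H_0(\mathrm{div})$ (face elements), $W_h\subset L_0^2$ (discontinuous piecewise polynomials) are finite element spaces on $\mathcal T_h$ such that $0\to S_h\xrightarrow{\mathrm{grad}}\boldsymbol U_h\xrightarrow{\mathrm{curl}}\boldsymbol V_h\xrightarrow{\mathrm{div}}W_h\to0$ is exact. Primes denote dual spaces and $\langle\cdot,\cdot\rangle$ the duality pairing. $\langle M_v\sigma,\tau\rangle=(\sigma,\tau)$ for $\sigma,\tau\in S_h$; $B:\boldsymbol U_h\to S_h'$, $\langle B\boldsymbol u,\tau\rangle=(\boldsymbol u,\mathrm{grad}\,\tau)$; $C^TM_fC:\boldsymbol U_h\to\boldsymbol U_h'$,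 $\langle C^TM_fC\boldsymbol u,\boldsymbol v\rangle=(\mathrm{curl}\,\boldsymbol u,\mathrm{curl}\,\boldsymbol v)$; and $A=C^TM_fC+B^TM_v^{-1}B$, which is symmetric positive definite. $\|\boldsymbol u\|_A^2=\langle A\boldsymbol u,\boldsymbol u\rangle$, $\|p\|_{M_v}^2=\langle M_vp,p\rangle$. The regularized system arises from the Maxwell problem $\mathrm{curl}\,\mathrm{curl}\,\boldsymbol u=\boldsymbol f$, $\mathrm{div}\,\boldsymbol u=0$ in $\Omega$, $\boldsymbol u\times\boldsymbol n=0$ on $\partial\Omega$, by imposing the constraint weakly with a multiplier $p\in S_h$ and adding $B^TM_v^{-1}B$ to the $(1,1)$ block. *)

theory Defs
  imports "HOL-Analysis.Analysis" "HOL-Library.Function_Algebras"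
begin

section \<open>Pointwise vector space structure on functions\<close>

instantiation "fun" :: (type, real_vector) real_vector
begin

definition scaleR_fun :: "real \<Rightarrow> ('a \<Rightarrow> 'b) \<Rightarrow> 'a \<Rightarrow> 'b"
  where "scaleR_fun r f = (\<lambda>x. r *\<^sub>R f x)"

instance
  by standard (simp_all add: scaleR_fun_def fun_eq_iff scaleR_add_left scaleR_add_right)

end

section \<open>Classical differential operators and Sobolev spaces\<close>

definition pd :: "3 \<Rightarrow> (real^3 \<Rightarrow> 'b::real_normed_vector) \<Rightarrow> real^3 \<Rightarrow> 'b"
  where "pd i f x = frechet_derivative f (at x) (axis i 1)"

definition grad :: "(real^3 \<Rightarrow> real) \<Rightarrow> real^3 \<Rightarrow> real^3"
  where "grad f x = (\<chi> i. pd i f x)"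

definition curl :: "(real^3 \<Rightarrow> real^3) \<Rightarrow> real^3 \<Rightarrow> real^3"
  where "curl u x = vector [pd 2 u x $ 3 - pd 3 u x $ 2,
                            pd 3 u x $ 1 - pd 1 u x $ 3,
                            pd 1 u x $ 2 - pd 2 u x $ 1]"

definition divg :: "(real^3 \<Rightarrow> real^3) \<Rightarrow> real^3 \<Rightarrow> real"
  where "divg u x = (\<Sum>i\<in>UNIV. pd i u x $ i)"

definition L2_inner :: "(real^3) set \<Rightarrow> (real^3 \<Rightarrow> 'b::euclidean_space) \<Rightarrow> (real^3 \<Rightarrow> 'b) \<Rightarrow> real"
  where "L2_inner \<Omega> f g = (LINT x:\<Omega>|lebesgue. f x \<bullet> g x)"

definition L2_norm :: "(real^3) set \<Rightarrow> (real^3 \<Rightarrow> 'b::euclidean_space) \<Rightarrow> real"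
  where "L2_norm \<Omega> f = sqrt (L2_inner \<Omega> f f)"

definition L2 :: "(real^3) set \<Rightarrow> (real^3 \<Rightarrow> 'b::euclidean_space) set"
  where "L2 \<Omega> = {f. set_borel_measurable lebesgue \<Omega> f \<and>
                     set_integrable lebesgue \<Omega> (\<lambda>x. (norm (f x))\<^sup>2)}"

definition L2_0 :: "(real^3) set \<Rightarrow> (real^3 \<Rightarrow> real) set"
  where "L2_0 \<Omega> = {f \<in> L2 \<Omega>. (LINT x:\<Omega>|lebesgue. f x) = 0}"

primrec Ck :: "nat \<Rightarrow> (real^3 \<Rightarrow> 'b::real_normed_vector) \<Rightarrow> bool" where
  "Ck 0 f \<longleftrightarrow> continuous_on UNIV f"
| "Ck (Suc k) f \<longleftrightarrow> f differentiable_on UNIV \<and> (\<forall>i. Ck k (pd i f))"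

definition test_functions :: "(real^3) set \<Rightarrow> (real^3 \<Rightarrow> 'b::real_normed_vector) set"
  where "test_functions \<Omega> =
    {\<phi>. (\<forall>k. Ck k \<phi>) \<and> (\<exists>K. compact K \<and> K \<subseteq> \<Omega> \<and> (\<forall>x. x \<notin> K \<longrightarrow> \<phi> x = 0))}"

text \<open>The closure of the smooth compactly supported functions in the graph norm of a first-order
  differential operator \<open>D\<close>; \<open>g\<close> below is the weak \<open>D f\<close>.\<close>

definition H0 :: "((real^3 \<Rightarrow> 'b::euclidean_space) \<Rightarrow> real^3 \<Rightarrow> 'c::euclidean_space)
    \<Rightarrow> (real^3) set \<Rightarrow> (real^3 \<Rightarrow> 'b) set"
  where "H0 D \<Omega> = {f \<in> L2 \<Omega>. \<exists>\<phi> g. g \<in> L2 \<Omega> \<and> (\<forall>n. \<phi> n \<in> test_functions \<Omega>) \<and>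
      (\<lambda>n. L2_norm \<Omega> (\<phi> n - f)) \<longlonglongrightarrow> 0 \<and>
      (\<lambda>n. L2_norm \<Omega> (D (\<phi> n) - g)) \<longlonglongrightarrow> 0}"

abbreviation "H1_0 \<equiv> H0 grad"
abbreviation "H0_curl \<equiv> H0 curl"
abbreviation "H0_div \<equiv> H0 divg"

section \<open>Domains and meshes\<close>

definition convex_polyhedral_domain :: "(real^3) set \<Rightarrow> bool"
  where "convex_polyhedral_domain \<Omega> \<longleftrightarrow>
    open \<Omega> \<and> bounded \<Omega> \<and> convex \<Omega> \<and> polyhedron (closure \<Omega>) \<and>
    \<Omega> homeomorphic ball (0 :: real^3) 1"

definition tetrahedral_mesh :: "(real^3) set \<Rightarrow> (real^3) set set \<Rightarrow> bool"
  where "tetrahedral_mesh \<Omega> \<T> \<longleftrightarrow>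
    triangulation \<T> \<and> (\<forall>K\<in>\<T>. 3 simplex K) \<and> \<Union>\<T> = closure \<Omega>"

definition mesh_size :: "(real^3) set set \<Rightarrow> real"
  where "mesh_size \<T> = Max (diameter ` \<T>)"

definition inradius :: "(real^3) set \<Rightarrow> real"
  where "inradius K = Sup {r. 0 \<le> r \<and> (\<exists>x. cball x r \<subseteq> K)}"

definition shape_regular :: "(real^3) set set set \<Rightarrow> bool"
  where "shape_regular \<F> \<longleftrightarrow>
    (\<exists>\<sigma>>0. \<forall>\<T>\<in>\<F>. \<forall>K\<in>\<T>. diameter K \<le> \<sigma> * inradius K)"

definition quasi_uniform :: "(real^3) set set set \<Rightarrow> bool"
  where "quasi_uniform \<F> \<longleftrightarrow>
    (\<exists>c>0. \<forall>\<T>\<in>\<F>. \<forall>K\<in>\<T>. c * mesh_size \<T> \<le> diameter K)"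

section \<open>Finite element spaces\<close>

definition Poly :: "nat \<Rightarrow> (real^3 \<Rightarrow> real) set"
  where "Poly k = span {\<lambda>x. \<Prod>i\<in>UNIV. (x $ i) ^ \<alpha> i | \<alpha>. (\<Sum>i\<in>UNIV. \<alpha> i) \<le> k}"

definition VPoly :: "nat \<Rightarrow> (real^3 \<Rightarrow> real^3) set"
  where "VPoly k = {a. \<forall>i. (\<lambda>x. a x $ i) \<in> Poly k}"

text \<open>Nedelec elements of the first and second kind, and their face counterparts
  (Raviart-Thomas and Brezzi-Douglas-Marini). The order \<open>k\<close> counts from \<open>0\<close>, the lowest-order
  element of the respective kind.\<close>

datatype element = First_Kind nat | Second_Kind nat

fun edge_shape :: "element \<Rightarrow> (real^3 \<Rightarrow> real^3) set" where
  "edge_shape (First_Kind k) = {\<lambda>x. a x + cross3 x (b x) | a b. a \<in> VPoly k \<and> b \<in> VPoly k}"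
| "edge_shape (Second_Kind k) = VPoly (Suc k)"

fun face_shape :: "element \<Rightarrow> (real^3 \<Rightarrow> real^3) set" where
  "face_shape (First_Kind k) = {\<lambda>x. a x + b x *\<^sub>R x | a b. a \<in> VPoly k \<and> b \<in> Poly k}"
| "face_shape (Second_Kind k) = VPoly (Suc k)"

definition skeleton_compl :: "(real^3) set set \<Rightarrow> (real^3) set"
  where "skeleton_compl \<T> = (\<Union>K\<in>\<T>. interior K)"

text \<open>Possibly discontinuous piecewise functions are only determined almost everywhere. We choose the
  representative that vanishes off the open cells, so that equality of finite element functions
  almost everywhere is plain equality.\<close>

definition broken :: "(real^3) set set \<Rightarrow> (real^3 \<Rightarrow> 'b::real_vector) set \<Rightarrow> (real^3 \<Rightarrow> 'b) set"
  where "broken \<T> P = {u. (\<forall>K\<in>\<T>. \<exists>q\<in>P. \<forall>x\<in>interior K. u x = q x) \<and>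
                          (\<forall>x. x \<notin> skeleton_compl \<T> \<longrightarrow> u x = 0)}"

text \<open>Lagrange functions of degree \<open>k + 1\<close> are represented by their continuous extension by zero.\<close>

definition Lagrange_space :: "(real^3) set \<Rightarrow> (real^3) set set \<Rightarrow> nat \<Rightarrow> (real^3 \<Rightarrow> real) set"
  where "Lagrange_space \<Omega> \<T> k = {p \<in> H1_0 \<Omega>. continuous_on UNIV p \<and>
    (\<forall>x. x \<notin> \<Omega> \<longrightarrow> p x = 0) \<and> (\<forall>K\<in>\<T>. \<exists>q\<in>Poly (Suc k). \<forall>x\<in>K. p x = q x)}"

definition edge_space :: "(real^3) set \<Rightarrow> (real^3) set set \<Rightarrow> element \<Rightarrow> (real^3 \<Rightarrow> real^3) set"
  where "edge_space \<Omega> \<T> e = H0_curl \<Omega> \<inter> broken \<T> (edge_shape e)"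

definition face_space :: "(real^3) set \<Rightarrow> (real^3) set set \<Rightarrow> element \<Rightarrow> (real^3 \<Rightarrow> real^3) set"
  where "face_space \<Omega> \<T> e = H0_div \<Omega> \<inter> broken \<T> (face_shape e)"

definition DG_space :: "(real^3) set \<Rightarrow> (real^3) set set \<Rightarrow> nat \<Rightarrow> (real^3 \<Rightarrow> real) set"
  where "DG_space \<Omega> \<T> k = L2_0 \<Omega> \<inter> broken \<T> (Poly k)"

text \<open>On finite element functions the weak operators act cellwise classically: on an open cell the
  weak derivative is the classical one, and the skeleton is a null set, where we again take the
  value \<open>0\<close>.\<close>

definition on_cells :: "(real^3) set set \<Rightarrow> (real^3 \<Rightarrow> 'c::zero) \<Rightarrow> real^3 \<Rightarrow> 'c"
  where "on_cells \<T> f x = (if x \<in> skeleton_compl \<T> then f x else 0)"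

definition grad_h :: "(real^3) set set \<Rightarrow> (real^3 \<Rightarrow> real) \<Rightarrow> real^3 \<Rightarrow> real^3"
  where "grad_h \<T> p = on_cells \<T> (grad p)"

definition curl_h :: "(real^3) set set \<Rightarrow> (real^3 \<Rightarrow> real^3) \<Rightarrow> real^3 \<Rightarrow> real^3"
  where "curl_h \<T> u = on_cells \<T> (curl u)"

definition div_h :: "(real^3) set set \<Rightarrow> (real^3 \<Rightarrow> real^3) \<Rightarrow> real^3 \<Rightarrow> real"
  where "div_h \<T> v = on_cells \<T> (divg v)"

definition exact_complex :: "(real^3) set set \<Rightarrow> (real^3 \<Rightarrow> real) set \<Rightarrow> (real^3 \<Rightarrow> real^3) set
    \<Rightarrow> (real^3 \<Rightarrow> real^3) set \<Rightarrow> (real^3 \<Rightarrow> real) set \<Rightarrow> bool"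
  where "exact_complex \<T> S U V W \<longleftrightarrow>
    {p \<in> S. grad_h \<T> p = 0} = {0} \<and>
    grad_h \<T> ` S = {u \<in> U. curl_h \<T> u = 0} \<and>
    curl_h \<T> ` U = {v \<in> V. div_h \<T> v = 0} \<and>
    div_h \<T> ` V = W"

section \<open>Operators into dual spaces\<close>

text \<open>The algebraic dual of a subspace \<open>X\<close>; functionals are \<open>undefined\<close> outside \<open>X\<close>. On the finite
  element spaces, being finite dimensional, it is the dual space.\<close>

definition dual :: "'v::real_vector set \<Rightarrow> ('v \<Rightarrow> real) set"
  where "dual X = {l \<in> extensional X.
    \<forall>x\<in>X. \<forall>y\<in>X. \<forall>a b. l (a *\<^sub>R x + b *\<^sub>R y) = a * l x + b * l y}"

type_synonym scal = "real^3 \<Rightarrow> real"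
type_synonym vect = "real^3 \<Rightarrow> real^3"

definition M_v :: "(real^3) set \<Rightarrow> scal set \<Rightarrow> scal \<Rightarrow> scal \<Rightarrow> real"
  where "M_v \<Omega> S \<sigma> = (\<lambda>\<tau>\<in>S. L2_inner \<Omega> \<sigma> \<tau>)"

definition B_op :: "(real^3) set \<Rightarrow> (real^3) set set \<Rightarrow> scal set \<Rightarrow> vect \<Rightarrow> scal \<Rightarrow> real"
  where "B_op \<Omega> \<T> S u = (\<lambda>\<tau>\<in>S. L2_inner \<Omega> u (grad_h \<T> \<tau>))"

definition BT_op :: "(real^3) set \<Rightarrow> (real^3) set set \<Rightarrow> scal set \<Rightarrow> vect set
    \<Rightarrow> scal \<Rightarrow> vect \<Rightarrow> real"
  where "BT_op \<Omega> \<T> S U p = (\<lambda>v\<in>U. B_op \<Omega> \<T> S v p)"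

definition CMC :: "(real^3) set \<Rightarrow> (real^3) set set \<Rightarrow> vect set \<Rightarrow> vect \<Rightarrow> vect \<Rightarrow> real"
  where "CMC \<Omega> \<T> U u = (\<lambda>v\<in>U. L2_inner \<Omega> (curl_h \<T> u) (curl_h \<T> v))"

definition A_op :: "(real^3) set \<Rightarrow> (real^3) set set \<Rightarrow> scal set \<Rightarrow> vect set
    \<Rightarrow> vect \<Rightarrow> vect \<Rightarrow> real"
  where "A_op \<Omega> \<T> S U u =
    (\<lambda>v\<in>U. CMC \<Omega> \<T> U u v + BT_op \<Omega> \<T> S U (inv_into S (M_v \<Omega> S) (B_op \<Omega> \<T> S u)) v)"

definition Maxwell_op :: "(real^3) set \<Rightarrow> (real^3) set set \<Rightarrow> scal set \<Rightarrow> vect set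
    \<Rightarrow> vect \<times> scal \<Rightarrow> (vect \<Rightarrow> real) \<times> (scal \<Rightarrow> real)"
  where "Maxwell_op \<Omega> \<T> S U = (\<lambda>(u, p).
    ((\<lambda>v\<in>U. A_op \<Omega> \<T> S U u v + BT_op \<Omega> \<T> S U p v), B_op \<Omega> \<T> S u))"

definition diag_precond :: "(real^3) set \<Rightarrow> (real^3) set set \<Rightarrow> scal set \<Rightarrow> vect set
    \<Rightarrow> (vect \<Rightarrow> real) \<times> (scal \<Rightarrow> real) \<Rightarrow> vect \<times> scal"
  where "diag_precond \<Omega> \<T> S U = (\<lambda>(f, g).
    (inv_into U (A_op \<Omega> \<T> S U) f, inv_into S (M_v \<Omega> S) g))"

definition product_norm :: "(real^3) set \<Rightarrow> (real^3) set set \<Rightarrow> scal set \<Rightarrow> vect set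
    \<Rightarrow> vect \<times> scal \<Rightarrow> real"
  where "product_norm \<Omega> \<T> S U = (\<lambda>(u, p).
    sqrt (A_op \<Omega> \<T> S U u u) + sqrt (M_v \<Omega> S p p))"

definition op_norm :: "'v set \<Rightarrow> ('v \<Rightarrow> real) \<Rightarrow> ('v \<Rightarrow> 'v) \<Rightarrow> real"
  where "op_norm X N T = Inf {c. 0 \<le> c \<and> (\<forall>x\<in>X. N (T x) \<le> c * N x)}"

definition condition_number :: "'v set \<Rightarrow> ('v \<Rightarrow> real) \<Rightarrow> ('v \<Rightarrow> 'v) \<Rightarrow> real"
  where "condition_number X N T = op_norm X N T * op_norm X N (inv_into X T)"

end

theory Submission
  imports Defs
begin

text \<open>Write \<open>G = M\<^sub>v\<^sup>-\<^sup>1 B\<close>. The preconditioned operator is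
  \<open>(u, p) \<mapsto> (u + A\<^sup>-\<^sup>1 B\<^sup>T p, G u)\<close>, and everything follows from the fact that
  \<open>A\<^sup>-\<^sup>1 B\<^sup>T\<close> is an isometric right inverse of \<open>G\<close>; equivalently, the Schur complement
  \<open>B A\<^sup>-\<^sup>1 B\<^sup>T\<close> is exactly \<open>M\<^sub>v\<close>.

  To see this, given \<open>p\<close> in \<open>S\<^sub>h\<close>, solve the discrete Poisson problem
  \<open>(grad r, grad q) = (p, q)\<close> for \<open>r\<close> in \<open>S\<^sub>h\<close> and put \<open>w = grad r\<close>. The complex property puts \<open>w\<close>
  into \<open>U\<^sub>h\<close> and makes it curl-free. By construction \<open>B w = M\<^sub>v p\<close>, so \<open>G w = p\<close>, and since \<open>w\<close> is
  curl-free, \<open>A w = B\<^sup>T G w = B\<^sup>T p\<close>. Hence \<open>A\<^sup>-\<^sup>1 B\<^sup>T p = w\<close>, and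
  \<open>\<parallel>w\<parallel>\<^sub>A = \<parallel>G w\<parallel> = \<parallel>p\<parallel>\<close> in the norm of \<open>M\<^sub>v\<close>. This map \<open>p \<mapsto> w\<close> is called \<open>lift\<close> below.

  Since \<open>\<parallel>G u\<parallel> \<le> \<parallel>u\<parallel>\<^sub>A\<close> by the form of the regularization term, the preconditioned operator has norm
  at most \<open>2\<close>. Its inverse is explicit, \<open>(f, g) \<mapsto> (f - lift (G f - g), G f - g)\<close>, and has norm at most
  \<open>3\<close>. This algebra is the content of the locale \<open>regularized_saddle\<close>; exactness of the complex at
  \<open>S\<^sub>h\<close> (injectivity of the gradient) makes the Poisson problem solvable, and exactness at \<open>U\<^sub>h\<close>
  makes \<open>A\<close> definite.

  The analytic part, culminating in \<open>discrete_Maxwell_saddle\<close>, shows that the finite element spaces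
  form such a structure. They must be linear spaces (which for \<open>H0\<close> rests on the triangle
  inequality in \<open>L\<^sup>2\<close>), finite dimensional (so that all functionals have Riesz representatives), and
  the \<open>L\<^sup>2\<close> product must be definite on them: a finite element function that vanishes almost
  everywhere vanishes everywhere.\<close>

section \<open>Semi-inner products on a subspace\<close>

text \<open>The forms of interest, integrals of products, are bilinear only on subspaces of the type of all
  functions, hence the relativization to a subspace \<open>X\<close>. Degenerate forms are included for the sake
  of the \<open>L\<^sup>2\<close> product on all square-integrable functions and of the curl form.\<close>

locale semi_inner_on =
  fixes X :: "'v::real_vector set" and b :: "'v \<Rightarrow> 'v \<Rightarrow> real"
  assumes subspace: "subspace X"
    and sym: "x \<in> X \<Longrightarrow> y \<in> X \<Longrightarrow> b x y = b y x"
    and add_left: "x \<in> X \<Longrightarrow> y \<in> X \<Longrightarrow> z \<in> X \<Longrightarrow> b (x + y) z = b x z + b y z"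
    and scale_left: "x \<in> X \<Longrightarrow> z \<in> X \<Longrightarrow> b (r *\<^sub>R x) z = r * b x z"
    and nonneg: "x \<in> X \<Longrightarrow> 0 \<le> b x x"
begin

lemma zero_closed [simp]: "0 \<in> X"
  and add_closed [simp]: "x \<in> X \<Longrightarrow> y \<in> X \<Longrightarrow> x + y \<in> X"
  and diff_closed [simp]: "x \<in> X \<Longrightarrow> y \<in> X \<Longrightarrow> x - y \<in> X"
  and scale_closed [simp]: "x \<in> X \<Longrightarrow> r *\<^sub>R x \<in> X"
  and uminus_closed [simp]: "x \<in> X \<Longrightarrow> - x \<in> X"
  using subspace by (auto simp: subspace_0 subspace_add subspace_diff subspace_scale subspace_neg)

lemma add_right: "x \<in> X \<Longrightarrow> y \<in> X \<Longrightarrow> z \<in> X \<Longrightarrow> b z (x + y) = b z x + b z y"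
  using add_left sym by simp

lemma scale_right: "x \<in> X \<Longrightarrow> z \<in> X \<Longrightarrow> b z (r *\<^sub>R x) = r * b z x"
  using scale_left sym by simp

lemma diff_left: "x \<in> X \<Longrightarrow> y \<in> X \<Longrightarrow> z \<in> X \<Longrightarrow> b (x - y) z = b x z - b y z"
  using add_left[of "x - y" y z] by simp

lemma diff_right: "x \<in> X \<Longrightarrow> y \<in> X \<Longrightarrow> z \<in> X \<Longrightarrow> b z (x - y) = b z x - b z y"
  using diff_left sym by simp

lemma zero_left [simp]: "z \<in> X \<Longrightarrow> b 0 z = 0"
  using scale_left[of 0 z 0] by simp

lemmas expand = add_left add_right scale_left scale_right diff_left diff_right

lemma Cauchy_Schwarz:
  assumes x: "x \<in> X" and y: "y \<in> X"
  shows "b x y \<le> sqrt (b x x) * sqrt (b y y)"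
proof -
  have quad: "0 \<le> b x x + 2 * t * b x y + t\<^sup>2 * b y y" for t
    using nonneg[of "x + t *\<^sub>R y"] x y sym[of y x]
    by (simp add: expand power2_eq_square algebra_simps)
  have "(b x y)\<^sup>2 \<le> b x x * b y y"
  proof (cases "b y y = 0")
    case True
    have "b x y = 0"
    proof (rule ccontr)
      assume "b x y \<noteq> 0"
      \<comment> \<open>With no quadratic term, \<open>quad\<close> is affine in \<open>t\<close>; this \<open>t\<close> gives it the value \<open>-1\<close>.\<close>
      then show False
        using quad[of "- (b x x + 1) / (2 * b x y)"] True by (simp add: field_simps)
    qed
    then show ?thesis using True by simp
  next
    case False
    then have "b y y > 0" using nonneg[OF y] by simp
    \<comment> \<open>Evaluate \<open>quad\<close> at its minimizer.\<close>
    then show ?thesis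
      using quad[of "- b x y / b y y"] by (simp add: field_simps power2_eq_square)
  qed
  then have "\<bar>b x y\<bar> \<le> sqrt (b x x * b y y)"
    using real_le_rsqrt by (metis power2_abs)
  then show ?thesis by (simp add: real_sqrt_mult)
qed

lemma triangle:
  assumes x: "x \<in> X" and y: "y \<in> X"
  shows "sqrt (b (x + y) (x + y)) \<le> sqrt (b x x) + sqrt (b y y)"
proof (rule real_le_lsqrt)
  show "b (x + y) (x + y) \<le> (sqrt (b x x) + sqrt (b y y))\<^sup>2"
    using Cauchy_Schwarz[OF x y] x y nonneg[OF x] nonneg[OF y] sym[of y x]
    by (simp add: expand power2_sum)
qed (use nonneg x y in auto)

lemma length_scale:
  "x \<in> X \<Longrightarrow> sqrt (b (r *\<^sub>R x) (r *\<^sub>R x)) = \<bar>r\<bar> * sqrt (b x x)"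
  by (simp add: expand real_sqrt_mult flip: mult.assoc)

lemma triangle_diff:
  assumes x: "x \<in> X" and y: "y \<in> X"
  shows "sqrt (b (x - y) (x - y)) \<le> sqrt (b x x) + sqrt (b y y)"
  using triangle[of x "(-1) *\<^sub>R y"] length_scale[of y "-1"] x y by simp

end

lemma dualD:
  assumes "l \<in> dual X" "x \<in> X" "y \<in> X"
  shows "l (a *\<^sub>R x + b *\<^sub>R y) = a * l x + b * l y"
  using assms by (auto simp: dual_def)

lemma dualI:
  assumes "l \<in> extensional X"
    and "\<And>x y a b. x \<in> X \<Longrightarrow> y \<in> X \<Longrightarrow> l (a *\<^sub>R x + b *\<^sub>R y) = a * l x + b * l y"
  shows "l \<in> dual X"
  using assms by (auto simp: dual_def)

locale inner_on = semi_inner_on +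
  assumes definite: "x \<in> X \<Longrightarrow> b x x = 0 \<Longrightarrow> x = 0"
    and finite_dim: "\<exists>B. finite B \<and> X = span B"
begin

text \<open>Gram-Schmidt: a vector representing \<open>l\<close> on the span of \<open>B\<close> is corrected, when \<open>c\<close> is adjoined,
  by a multiple of the component \<open>w\<close> of \<open>c\<close> orthogonal to \<open>B\<close>. That component is itself an instance
  of the induction hypothesis, applied to the functional \<open>b c\<close>.\<close>

lemma represent_on_span:
  assumes "finite B" "B \<subseteq> X" "l \<in> dual X"
  shows "\<exists>x\<in>span B. \<forall>y\<in>span B. b x y = l y"
  using assms
proof (induction B arbitrary: l rule: finite_induct)
  case empty
  then show ?case using dualD[of l X 0 0 0 0] by simp
next
  case (insert c B)
  have cX: "c \<in> X" and BX: "span B \<subseteq> X"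
    using insert.prems subspace by (auto intro: span_minimal[THEN subsetD])
  obtain x where x: "x \<in> span B" and xl: "\<And>y. y \<in> span B \<Longrightarrow> b x y = l y"
    using insert by blast
  have "restrict (b c) X \<in> dual X"
    using cX by (auto intro!: dualI simp: expand)
  then obtain z where z: "z \<in> span B" and "\<And>y. y \<in> span B \<Longrightarrow> b z y = restrict (b c) X y"
    using insert.IH[of "restrict (b c) X"] insert.prems by blast
  then have zc: "b z y = b c y" if "y \<in> span B" for y
    using that BX by (metis restrict_apply' subsetD)
  define w where "w = c - z"
  have X: "x \<in> X" "z \<in> X" "w \<in> X" using x z BX cX by (auto simp: w_def)
  have orth: "b w y = 0" if "y \<in> span B" for y
    using that zc[OF that] X cX BX by (auto simp: w_def diff_left)
  \<comment> \<open>If \<open>c\<close> already lies in the span of \<open>B\<close>, then \<open>w = 0\<close> and the quotient is \<open>0\<close>.\<close>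
  define t where "t = (l w - b x w) / b w w"
  have tw: "t * b w w = l w - b x w"
  proof (cases "b w w = 0")
    case True
    then have w0: "w = 0" using definite X by blast
    have "l 0 = 0" using dualD[OF \<open>l \<in> dual X\<close>, of 0 0 0 0] by simp
    then show ?thesis using w0 X sym[of x 0] by simp
  qed (simp add: t_def)
  show ?case
  proof (intro bexI ballI)
    have "w \<in> span (insert c B)"
      unfolding w_def using z by (meson insertI1 span_base span_diff span_mono subsetD subset_insertI)
    then show "x + t *\<^sub>R w \<in> span (insert c B)"
      using x by (meson span_add span_scale span_mono subsetD subset_insertI)
    fix y assume "y \<in> span (insert c B)"
    then obtain k where k: "y - k *\<^sub>R c \<in> span B" by (auto simp: span_breakdown_eq)
    define y' where "y' = y - k *\<^sub>R c + k *\<^sub>R z"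
    have y': "y' \<in> span B" using k z by (simp add: y'_def span_add span_scale)
    have y: "y = 1 *\<^sub>R y' + k *\<^sub>R w" by (simp add: y'_def w_def algebra_simps)
    have "y' \<in> X" using y' BX by blast
    then have "b (x + t *\<^sub>R w) y = b x y' + k * b x w + k * (t * b w w)"
      using X orth[OF y'] unfolding y by (simp add: expand algebra_simps)
    also have "\<dots> = b x y' + k * (b x w + t * b w w)" by (simp add: algebra_simps)
    also have "\<dots> = l y' + k * l w" using xl[OF y'] tw by simp
    also have "\<dots> = l y"
      unfolding y using dualD[OF \<open>l \<in> dual X\<close> \<open>y' \<in> X\<close> \<open>w \<in> X\<close>, of 1 k] by simp
    finally show "b (x + t *\<^sub>R w) y = l y" .
  qed
qed

lemma Riesz: "bij_betw (\<lambda>x. \<lambda>y\<in>X. b x y) X (dual X)"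
proof (rule bij_betw_imageI)
  show "inj_on (\<lambda>x. \<lambda>y\<in>X. b x y) X"
  proof (rule inj_onI)
    fix x x' assume x: "x \<in> X" "x' \<in> X" and eq: "(\<lambda>y\<in>X. b x y) = (\<lambda>y\<in>X. b x' y)"
    have "b x (x - x') = b x' (x - x')"
      using fun_cong[OF eq, of "x - x'"] x by simp
    then have "b (x - x') (x - x') = 0" using x by (simp add: diff_left)
    then show "x = x'" using definite[of "x - x'"] x by simp
  qed
  show "(\<lambda>x. \<lambda>y\<in>X. b x y) ` X = dual X"
  proof (intro equalityI subsetI)
    fix l assume "l \<in> (\<lambda>x. \<lambda>y\<in>X. b x y) ` X"
    then show "l \<in> dual X" by (auto intro!: dualI simp: expand)
  next
    fix l assume l: "l \<in> dual X"
    obtain B where "finite B" "X = span B" using finite_dim by blast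
    then obtain x where "x \<in> X" "\<forall>y\<in>X. b x y = l y"
      using represent_on_span[OF _ _ l, of B] span_base by blast
    moreover from this l have "(\<lambda>y\<in>X. b x y) = l"
      by (auto simp: dual_def extensional_def fun_eq_iff)
    ultimately show "l \<in> (\<lambda>x. \<lambda>y\<in>X. b x y) ` X" by blast
  qed
qed

end

section \<open>The preconditioned saddle point operator\<close>

lemma op_norm_le:
  assumes "0 \<le> C" "\<And>x. x \<in> X \<Longrightarrow> N (T x) \<le> C * N x"
  shows "op_norm X N T \<le> C" "0 \<le> op_norm X N T"
proof -
  show "op_norm X N T \<le> C"
    unfolding op_norm_def using assms by (intro cInf_lower bdd_belowI[of _ 0]) auto
  show "0 \<le> op_norm X N T"
    unfolding op_norm_def using assms by (intro cInf_greatest) auto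
qed

text \<open>The abstract form of the problem: \<open>m\<close> is the mass form on \<open>S\<close>, \<open>i\<close> and \<open>c\<close> are the \<open>L\<^sup>2\<close> product and
  the curl form on \<open>U\<close>, and \<open>D\<close> is the gradient. The curl itself enters only through the
  condition that the null vectors of \<open>c\<close> are the gradients.\<close>

locale regularized_saddle =
  M: inner_on S m + I: semi_inner_on U i + C: semi_inner_on U c
  for S :: "'s::real_vector set" and m and U :: "'u::real_vector set" and i c +
  fixes D :: "'s \<Rightarrow> 'u"
  assumes D_closed [simp]: "p \<in> S \<Longrightarrow> D p \<in> U"
    and D_add: "p \<in> S \<Longrightarrow> q \<in> S \<Longrightarrow> D (p + q) = D p + D q"
    and D_scale: "p \<in> S \<Longrightarrow> D (r *\<^sub>R p) = r *\<^sub>R D p"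
    and D_injective: "p \<in> S \<Longrightarrow> D p = 0 \<Longrightarrow> p = 0"
    and curl_kernel: "u \<in> U \<Longrightarrow> c u u = 0 \<longleftrightarrow> u \<in> D ` S"
    and i_definite: "u \<in> U \<Longrightarrow> i u u = 0 \<Longrightarrow> u = 0"
    and finite_dim_U: "\<exists>B. finite B \<and> U = span B"
begin

definition mass :: "'s \<Rightarrow> 's \<Rightarrow> real"
  where "mass \<sigma> = (\<lambda>\<tau>\<in>S. m \<sigma> \<tau>)"

definition constraint :: "'u \<Rightarrow> 's \<Rightarrow> real"
  where "constraint u = (\<lambda>\<tau>\<in>S. i u (D \<tau>))"

definition G :: "'u \<Rightarrow> 's"
  where "G u = inv_into S mass (constraint u)"

text \<open>The last term is \<open>i v (D (G u))\<close> whenever \<open>G u\<close> lies in \<open>S\<close>. Applying the functional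
  \<open>constraint v\<close> instead makes \<open>a\<close> agree with the form of \<open>A_op\<close> at all arguments, including those
  outside \<open>U\<close>, so that the operators can be identified by plain equality.\<close>

definition a :: "'u \<Rightarrow> 'u \<Rightarrow> real"
  where "a u v = c u v + constraint v (G u)"

definition stiffness :: "'u \<Rightarrow> 'u \<Rightarrow> real"
  where "stiffness u = (\<lambda>v\<in>U. a u v)"

definition saddle :: "'u \<times> 's \<Rightarrow> ('u \<Rightarrow> real) \<times> ('s \<Rightarrow> real)"
  where "saddle = (\<lambda>(u, p). ((\<lambda>v\<in>U. a u v + constraint v p), constraint u))"

definition precond :: "('u \<Rightarrow> real) \<times> ('s \<Rightarrow> real) \<Rightarrow> 'u \<times> 's"
  where "precond = (\<lambda>(f, g). (inv_into U stiffness f, inv_into S mass g))"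

definition N :: "'u \<times> 's \<Rightarrow> real"
  where "N = (\<lambda>(u, p). sqrt (stiffness u u) + sqrt (mass p p))"

text \<open>The form of the discrete Laplacian is positive definite because the gradient is injective.\<close>

sublocale L: inner_on S "\<lambda>p q. i (D p) (D q)"
proof
  show "subspace S" by (rule M.subspace)
  show "\<exists>B. finite B \<and> S = span B" by (rule M.finite_dim)
  show "p = 0" if "p \<in> S" "i (D p) (D p) = 0" for p
    using that i_definite[of "D p"] D_injective by simp
qed (auto simp: D_add D_scale I.expand I.nonneg intro: I.sym)

lemma mass_bij: "bij_betw mass S (dual S)"
  using M.Riesz unfolding mass_def[abs_def] .

lemma constraint_dual: "u \<in> U \<Longrightarrow> constraint u \<in> dual S"
  by (auto intro!: dualI simp: constraint_def D_add D_scale I.expand)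

lemma G_closed [simp]: "u \<in> U \<Longrightarrow> G u \<in> S"
  unfolding G_def using constraint_dual mass_bij by (metis bij_betw_def inv_into_into)

lemma mass_G: "u \<in> U \<Longrightarrow> mass (G u) = constraint u"
  unfolding G_def using constraint_dual mass_bij by (metis bij_betw_inv_into_right)

lemma G_eqI: "u \<in> U \<Longrightarrow> p \<in> S \<Longrightarrow> mass p = constraint u \<Longrightarrow> G u = p"
  unfolding G_def using mass_bij by (metis bij_betw_inv_into_left)

lemma m_G: "u \<in> U \<Longrightarrow> \<tau> \<in> S \<Longrightarrow> m (G u) \<tau> = i u (D \<tau>)"
  using fun_cong[OF mass_G, of u \<tau>] by (simp add: mass_def constraint_def)

lemma a_eq: "u \<in> U \<Longrightarrow> v \<in> U \<Longrightarrow> a u v = c u v + m (G u) (G v)"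
  using m_G[of v "G u"] M.sym by (simp add: a_def constraint_def)

lemma G_add: "u \<in> U \<Longrightarrow> v \<in> U \<Longrightarrow> G (u + v) = G u + G v"
  by (rule G_eqI) (auto simp: mass_def constraint_def fun_eq_iff M.expand I.expand m_G)

lemma G_scale: "u \<in> U \<Longrightarrow> G (r *\<^sub>R u) = r *\<^sub>R G u"
  by (rule G_eqI) (auto simp: mass_def constraint_def fun_eq_iff M.expand I.expand m_G)

lemma G_diff: "u \<in> U \<Longrightarrow> v \<in> U \<Longrightarrow> G (u - v) = G u - G v"
  using G_add[of "u - v" v] by simp

text \<open>Definiteness is a discrete Helmholtz argument: a null vector \<open>u\<close> of \<open>a\<close> is curl-free, hence a
  gradient, and it is orthogonal to all gradients because \<open>G u = 0\<close>; so it is orthogonal to itself.\<close>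

sublocale A: inner_on U a
proof
  show "subspace U" by (rule I.subspace)
  show "\<exists>B. finite B \<and> U = span B" by (rule finite_dim_U)
  show "u = 0" if "u \<in> U" "a u u = 0" for u
  proof -
    have "c u u = 0" "m (G u) (G u) = 0"
      using that C.nonneg[of u] M.nonneg[of "G u"] by (auto simp: a_eq add_nonneg_eq_0_iff)
    then have G0: "G u = 0" using M.definite that by simp
    obtain p where p: "p \<in> S" "u = D p"
      using curl_kernel[OF \<open>u \<in> U\<close>] \<open>c u u = 0\<close> by auto
    have "i u u = m (G u) p" using m_G[of u p] p that by simp
    then show "u = 0" using G0 p i_definite that by simp
  qed
  fix u v assume u: "u \<in> U" and v: "v \<in> U"
  show "a u v = a v u"
    using u v C.sym[of u v] M.sym[of "G u" "G v"] by (simp add: a_eq)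
next
  fix u v w assume "u \<in> U" "v \<in> U" "w \<in> U"
  then show "a (u + v) w = a u w + a v w"
    by (simp add: a_eq G_add C.add_left M.add_left)
next
  fix r u v assume "u \<in> U" "v \<in> U"
  then show "a (r *\<^sub>R u) v = r * a u v"
    by (simp add: a_eq G_scale C.scale_left M.scale_left distrib_left)
qed (simp add: a_eq C.nonneg M.nonneg)

lemma stiffness_bij: "bij_betw stiffness U (dual U)"
  using A.Riesz unfolding stiffness_def[abs_def] .

text \<open>By the Cauchy-Schwarz inequality a null vector of \<open>c\<close> pairs nonpositively with every vector;
  testing with \<open>v\<close> and \<open>- v\<close> gives equality.\<close>

lemma c_gradient:
  assumes p: "p \<in> S" and v: "v \<in> U"
  shows "c (D p) v = 0"
proof -
  have "c (D p) (D p) = 0" using curl_kernel p by auto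
  then have "c (D p) w \<le> 0" if "w \<in> U" for w
    using C.Cauchy_Schwarz[of "D p" w] that p by simp
  from this[of v] this[of "(-1) *\<^sub>R v"] show ?thesis
    using C.scale_right[of v "D p" "-1"] p v by (simp del: scaleR_minus1_left)
qed

text \<open>The lift of \<open>p\<close> is the gradient of the solution of the discrete Poisson problem with right-hand
  side \<open>p\<close>. It is a right inverse of \<open>G\<close>, and, as gradients are curl-free, it also represents
  \<open>B\<^sup>T p\<close> with respect to the form \<open>a\<close>. Hence \<open>A\<^sup>-\<^sup>1 B\<^sup>T\<close> is an isometric right inverse of
  \<open>M\<^sub>v\<^sup>-\<^sup>1 B\<close>: the Schur complement \<open>B A\<^sup>-\<^sup>1 B\<^sup>T\<close> is exactly \<open>M\<^sub>v\<close>.\<close>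

definition lift :: "'s \<Rightarrow> 'u"
  where "lift p = D (inv_into S (\<lambda>r. \<lambda>q\<in>S. i (D r) (D q)) (mass p))"

lemma lift_solves:
  assumes "p \<in> S"
  obtains r where "r \<in> S" "lift p = D r" "constraint (D r) = mass p"
proof
  let ?K = "\<lambda>r. \<lambda>q\<in>S. i (D r) (D q)"
  have p: "mass p \<in> ?K ` S"
    using mass_bij L.Riesz assms by (metis bij_betw_apply bij_betw_imp_surj_on)
  show "inv_into S ?K (mass p) \<in> S" using p by (rule inv_into_into)
  show "lift p = D (inv_into S ?K (mass p))" by (simp add: lift_def)
  show "constraint (D (inv_into S ?K (mass p))) = mass p"
    using f_inv_into_f[OF p] by (simp add: constraint_def)
qed

lemma lift_closed [simp]: "p \<in> S \<Longrightarrow> lift p \<in> U"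
  by (erule lift_solves) simp

lemma G_lift [simp]:
  assumes "p \<in> S"
  shows "G (lift p) = p"
proof -
  obtain r where "r \<in> S" "lift p = D r" "constraint (D r) = mass p"
    using assms by (rule lift_solves)
  then show ?thesis using G_eqI[of "D r" p] assms by simp
qed

lemma a_lift:
  assumes "p \<in> S" "v \<in> U"
  shows "a (lift p) v = i v (D p)"
proof -
  have "c (lift p) v = 0"
    using assms(1) by (rule lift_solves) (simp add: c_gradient assms)
  then show ?thesis using assms by (simp add: a_def constraint_def)
qed

lemma lift_isometry: "p \<in> S \<Longrightarrow> a (lift p) (lift p) = m p p"
  using a_lift[of p "lift p"] m_G[of "lift p" p] by simp

definition T :: "'u \<times> 's \<Rightarrow> 'u \<times> 's"
  where "T = (\<lambda>(u, p). (u + lift p, G u))"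

definition T_inv :: "'u \<times> 's \<Rightarrow> 'u \<times> 's"
  where "T_inv = (\<lambda>(f, g). (f - lift (G f - g), G f - g))"

text \<open>Substituting \<open>B\<^sup>T p = A (lift p)\<close> in the first row and \<open>B u = M\<^sub>v (G u)\<close> in the second exhibits the
  saddle point operator as the diagonal operator after \<open>T\<close>; so \<open>T\<close> is the preconditioned operator.\<close>

lemma saddle_factor: "u \<in> U \<Longrightarrow> p \<in> S \<Longrightarrow> saddle (u, p) = map_prod stiffness mass (T (u, p))"
  by (auto simp: saddle_def T_def stiffness_def constraint_def mass_G a_lift A.add_left fun_eq_iff)

lemma T_bij: "bij_betw T (U \<times> S) (U \<times> S)"
  by (rule bij_betw_byWitness[where f' = T_inv])
    (auto simp: T_def T_inv_def G_add G_diff)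

lemma T_inv_eq: "x \<in> U \<times> S \<Longrightarrow> inv_into (U \<times> S) T x = T_inv x"
  by (rule inv_into_f_eq) (use T_bij in \<open>auto simp: bij_betw_def T_def T_inv_def G_diff\<close>)

lemma saddle_bij: "bij_betw saddle (U \<times> S) (dual U \<times> dual S)"
proof -
  have "bij_betw (map_prod stiffness mass \<circ> T) (U \<times> S) (dual U \<times> dual S)"
    using T_bij bij_betw_map_prod[OF stiffness_bij mass_bij] by (rule bij_betw_trans)
  then show ?thesis
    by (rule bij_betw_cong[THEN iffD2, rotated]) (auto simp: saddle_factor)
qed

lemma preconditioned: "x \<in> U \<times> S \<Longrightarrow> (precond \<circ> saddle) x = T x"
  using bij_betw_inv_into_left[OF stiffness_bij] bij_betw_inv_into_left[OF mass_bij]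
  by (auto simp: saddle_factor precond_def T_def)

lemma N_eq: "u \<in> U \<Longrightarrow> p \<in> S \<Longrightarrow> N (u, p) = sqrt (a u u) + sqrt (m p p)"
  by (simp add: N_def stiffness_def mass_def)

text \<open>\<open>m (G u) (G u)\<close> is the regularization part of \<open>a u u\<close>, the other part \<open>c u u\<close> being nonnegative.\<close>

lemma G_bound: "u \<in> U \<Longrightarrow> sqrt (m (G u) (G u)) \<le> sqrt (a u u)"
  by (simp add: a_eq C.nonneg)

lemma T_bound:
  assumes "x \<in> U \<times> S"
  shows "N (T x) \<le> 2 * N x"
proof -
  obtain u p where x: "x = (u, p)" "u \<in> U" "p \<in> S" using assms by auto
  show ?thesis
    using A.triangle[of u "lift p"] G_bound[of u] real_sqrt_ge_zero[OF M.nonneg, of p] x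
    by (simp add: N_eq T_def lift_isometry del: real_sqrt_le_iff real_sqrt_ge_0_iff)
qed

lemma T_inv_bound:
  assumes "x \<in> U \<times> S"
  shows "N (T_inv x) \<le> 3 * N x"
proof -
  obtain f g where x: "x = (f, g)" "f \<in> U" "g \<in> S" using assms by auto
  \<comment> \<open>The length of \<open>G f - g\<close> enters twice, as the second component and, through the isometry \<open>lift\<close>, in
    the first; together with \<open>f\<close> itself this gives the factor \<open>3\<close>.\<close>
  have "sqrt (m (G f - g) (G f - g)) \<le> sqrt (a f f) + sqrt (m g g)"
    using M.triangle_diff[of "G f" g] G_bound[of f] x by (simp del: real_sqrt_le_iff real_sqrt_ge_0_iff)
  then show ?thesis
    using A.triangle_diff[of f "lift (G f - g)"] real_sqrt_ge_zero[OF M.nonneg, of g] x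
    by (simp add: N_eq T_inv_def lift_isometry del: real_sqrt_le_iff real_sqrt_ge_0_iff)
qed

text \<open>The bounds for \<open>T\<close> and its inverse, transferred to the composition of the given operators. The
  two are equal on \<open>U \<times> S\<close> only, so the inverses, being defined by a choice over that set, have to be
  identified separately.\<close>

lemma uniform_preconditioner:
  defines "P \<equiv> precond \<circ> saddle"
  shows "bij_betw P (U \<times> S) (U \<times> S)"
    and "x \<in> U \<times> S \<Longrightarrow> N (P x) \<le> 2 * N x"
    and "x \<in> U \<times> S \<Longrightarrow> N (inv_into (U \<times> S) P x) \<le> 3 * N x"
    and "condition_number (U \<times> S) N P \<le> 6"
proof -
  have inv: "inv_into (U \<times> S) P x = T_inv x" if "x \<in> U \<times> S" for x
  proof -
    have "inv_into (U \<times> S) P x = inv_into (U \<times> S) T x"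
      unfolding inv_into_def P_def
      by (rule arg_cong[where f = Eps]) (auto simp: fun_eq_iff preconditioned simp del: o_apply)
    then show ?thesis using T_inv_eq that by simp
  qed
  show "bij_betw P (U \<times> S) (U \<times> S)"
    using T_bij unfolding P_def
    by (rule bij_betw_cong[THEN iffD2, rotated]) (rule preconditioned)
  show b: "N (P x) \<le> 2 * N x" if "x \<in> U \<times> S" for x
    using T_bound preconditioned that by (simp add: P_def)
  show b': "N (inv_into (U \<times> S) P x) \<le> 3 * N x" if "x \<in> U \<times> S" for x
    using T_inv_bound inv that by simp
  have "op_norm (U \<times> S) N P * op_norm (U \<times> S) N (inv_into (U \<times> S) P) \<le> 2 * 3"
    using op_norm_le[of 2 "U \<times> S" N P] op_norm_le[of 3 "U \<times> S" N "inv_into (U \<times> S) P"] b b'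
    by (intro mult_mono) simp_all
  then show "condition_number (U \<times> S) N P \<le> 6" by (simp add: condition_number_def)
qed

end

section \<open>Square-integrable functions\<close>

lemma scaleR_fun_apply [simp]: "(r *\<^sub>R f) x = r *\<^sub>R f x"
  by (simp add: scaleR_fun_def)

lemma L2_iff:
  "f \<in> L2 \<Omega> \<longleftrightarrow> (\<lambda>x. indicator \<Omega> x *\<^sub>R f x) \<in> borel_measurable lebesgue \<and>
    integrable lebesgue (\<lambda>x. indicator \<Omega> x * (norm (f x))\<^sup>2)"
  by (simp add: L2_def set_borel_measurable_def set_integrable_def)

text \<open>Measurability is known only for the product of \<open>f\<close> with the indicator function, so the factors
  carry the indicator separately when they are multiplied.\<close>

lemma L2_inner_integrable:
  fixes f g :: "real^3 \<Rightarrow> 'b::euclidean_space"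
  assumes "f \<in> L2 \<Omega>" "g \<in> L2 \<Omega>"
  shows "set_integrable lebesgue \<Omega> (\<lambda>x. f x \<bullet> g x)"
  unfolding set_integrable_def
proof (rule Bochner_Integration.integrable_bound)
  show "integrable lebesgue (\<lambda>x. indicator \<Omega> x * (norm (f x))\<^sup>2 + indicator \<Omega> x * (norm (g x))\<^sup>2)"
    using assms by (simp add: L2_iff)
  have "(\<lambda>x. (indicator \<Omega> x *\<^sub>R f x) \<bullet> (indicator \<Omega> x *\<^sub>R g x)) \<in> borel_measurable lebesgue"
    using assms unfolding L2_iff by (intro borel_measurable_inner) auto
  then show "(\<lambda>x. indicator \<Omega> x *\<^sub>R (f x \<bullet> g x)) \<in> borel_measurable lebesgue"
    by (rule measurable_cong[THEN iffD1, rotated]) (auto simp: indicator_def)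
  have "\<bar>f x \<bullet> g x\<bar> \<le> (norm (f x))\<^sup>2 + (norm (g x))\<^sup>2" for x
    using Cauchy_Schwarz_ineq2[of "f x" "g x"] sum_squares_bound[of "norm (f x)" "norm (g x)"]
      mult_nonneg_nonneg[OF norm_ge_zero[of "f x"] norm_ge_zero[of "g x"]] by linarith
  then show "AE x in lebesgue. norm (indicator \<Omega> x *\<^sub>R (f x \<bullet> g x))
      \<le> norm (indicator \<Omega> x * (norm (f x))\<^sup>2 + indicator \<Omega> x * (norm (g x))\<^sup>2)"
    by (auto simp: indicator_def)
qed

lemma subspace_L2: "subspace (L2 \<Omega> :: (real^3 \<Rightarrow> 'b::euclidean_space) set)"
  unfolding subspace_def
proof (intro conjI ballI allI)
  show "0 \<in> (L2 \<Omega> :: (real^3 \<Rightarrow> 'b) set)" by (simp add: L2_iff)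
next
  fix f g :: "real^3 \<Rightarrow> 'b" assume fg: "f \<in> L2 \<Omega>" "g \<in> L2 \<Omega>"
  have meas: "(\<lambda>x. indicator \<Omega> x *\<^sub>R (f + g) x) \<in> borel_measurable lebesgue"
    using fg by (auto simp: L2_iff scaleR_add_right intro: borel_measurable_add)
  show "f + g \<in> L2 \<Omega>"
    unfolding L2_iff
  proof (intro conjI meas, rule Bochner_Integration.integrable_bound)
    show "integrable lebesgue
        (\<lambda>x. 2 * (indicator \<Omega> x * (norm (f x))\<^sup>2) + 2 * (indicator \<Omega> x * (norm (g x))\<^sup>2))"
      using fg by (simp add: L2_iff)
    have "(\<lambda>x. (norm (indicator \<Omega> x *\<^sub>R (f + g) x))\<^sup>2) \<in> borel_measurable lebesgue"
      using meas by measurable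
    then show "(\<lambda>x. indicator \<Omega> x * (norm ((f + g) x))\<^sup>2) \<in> borel_measurable lebesgue"
      by (rule measurable_cong[THEN iffD1, rotated]) (auto simp: indicator_def)
    have "(norm (f x + g x))\<^sup>2 \<le> 2 * (norm (f x))\<^sup>2 + 2 * (norm (g x))\<^sup>2" for x
      using power_mono[OF norm_triangle_ineq[of "f x" "g x"] norm_ge_zero, of 2]
        sum_squares_bound[of "norm (f x)" "norm (g x)"]
      by (simp add: power2_sum)
    then show "AE x in lebesgue. norm (indicator \<Omega> x * (norm ((f + g) x))\<^sup>2)
        \<le> norm (2 * (indicator \<Omega> x * (norm (f x))\<^sup>2) + 2 * (indicator \<Omega> x * (norm (g x))\<^sup>2))"
      by (auto simp: indicator_def)
  qed
next
  fix r and f :: "real^3 \<Rightarrow> 'b" assume f: "f \<in> L2 \<Omega>"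
  have "(\<lambda>x. r *\<^sub>R (indicator \<Omega> x *\<^sub>R f x)) \<in> borel_measurable lebesgue"
    using f by (intro borel_measurable_scaleR[OF borel_measurable_const]) (simp add: L2_iff)
  moreover have "integrable lebesgue (\<lambda>x. r\<^sup>2 * (indicator \<Omega> x * (norm (f x))\<^sup>2))"
    using f by (simp add: L2_iff)
  ultimately show "r *\<^sub>R f \<in> L2 \<Omega>"
    by (simp add: L2_iff scaleR_fun_def power_mult_distrib ac_simps)
qed

interpretation L2: semi_inner_on "L2 \<Omega> :: (real^3 \<Rightarrow> 'b::euclidean_space) set" "L2_inner \<Omega>" for \<Omega>
proof
  fix f g k :: "real^3 \<Rightarrow> 'b" and r
  assume f: "f \<in> L2 \<Omega>" and k: "k \<in> L2 \<Omega>"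
  show "L2_inner \<Omega> f k = L2_inner \<Omega> k f" by (simp add: L2_inner_def inner_commute)
  show "0 \<le> L2_inner \<Omega> f f"
    unfolding L2_inner_def set_lebesgue_integral_def by (rule integral_nonneg_AE) auto
  show "L2_inner \<Omega> (r *\<^sub>R f) k = r * L2_inner \<Omega> f k"
    by (simp add: L2_inner_def scaleR_fun_def)
  assume g: "g \<in> L2 \<Omega>"
  show "L2_inner \<Omega> (f + g) k = L2_inner \<Omega> f k + L2_inner \<Omega> g k"
    using L2_inner_integrable[OF f k] L2_inner_integrable[OF g k]
    by (simp add: L2_inner_def inner_add_left)
qed (rule subspace_L2)

text \<open>The set where \<open>f\<close> does not vanish inside \<open>E\<close> is open by continuity and negligible by the vanishing
  of the integral, and a nonempty open set is not negligible.\<close>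

lemma L2_null_imp_zero:
  fixes f :: "real^3 \<Rightarrow> 'b::euclidean_space"
  assumes f: "f \<in> L2 \<Omega>" and null: "L2_inner \<Omega> f f = 0"
    and E: "open E" "E \<subseteq> \<Omega>" and cont: "continuous_on E f" and x: "x \<in> E"
  shows "f x = 0"
proof (rule ccontr)
  assume nz: "f x \<noteq> 0"
  define E' where "E' = E \<inter> f -` (- {0})"
  have "open E'" unfolding E'_def using E cont by (intro continuous_open_preimage) auto
  moreover have "E' \<noteq> {}" using x nz by (auto simp: E'_def)
  moreover have "negligible E'"
  proof -
    have "AE y in lebesgue. indicator \<Omega> y *\<^sub>R (f y \<bullet> f y) = 0"
      using null L2_inner_integrable[OF f f]
      unfolding L2_inner_def set_lebesgue_integral_def set_integrable_def
      by (subst (asm) integral_nonneg_eq_0_iff_AE) auto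
    then have "AE y in lebesgue. y \<notin> E'"
      by eventually_elim (use E in \<open>auto simp: E'_def\<close>)
    then show ?thesis
      by (simp add: negligible_iff_null_sets AE_iff_null_sets[symmetric] \<open>open E'\<close>)
  qed
  ultimately show False using open_not_negligible by blast
qed

lemma continuous_imp_L2:
  fixes f :: "real^3 \<Rightarrow> 'b::euclidean_space"
  assumes cont: "continuous_on UNIV f" and \<Omega>: "open \<Omega>" "bounded \<Omega>"
  shows "f \<in> L2 \<Omega>"
proof -
  have integrable: "set_integrable lebesgue \<Omega> g"
    if "continuous_on UNIV g" for g :: "real^3 \<Rightarrow> real"
  proof -
    have "set_integrable lborel (closure \<Omega>) g"
      using \<Omega> continuous_on_subset[OF that subset_UNIV]
      unfolding set_integrable_def by (intro borel_integrable_compact) (auto simp: compact_closure)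
    then have "set_integrable lebesgue (closure \<Omega>) g"
      unfolding set_integrable_def
      by (metis borel_measurable_integrable integrable_completion)
    then show ?thesis
      by (rule set_integrable_subset) (use \<Omega> closure_subset in auto)
  qed
  have "f \<in> borel_measurable lborel" using cont by (simp add: borel_measurable_continuous_onI)
  then have "f \<in> borel_measurable lebesgue" by (rule measurable_completion)
  moreover have "\<Omega> \<in> sets lebesgue" using \<Omega> by simp
  ultimately have "(\<lambda>x. indicator \<Omega> x *\<^sub>R f x) \<in> borel_measurable lebesgue" by measurable
  moreover have "set_integrable lebesgue \<Omega> (\<lambda>x. (norm (f x))\<^sup>2)"
    using cont by (intro integrable continuous_intros)
  ultimately show ?thesis by (simp add: L2_def set_borel_measurable_def)
qed

section \<open>Linearity of the differential operators\<close>

lemma pd_add: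
  assumes "f differentiable (at x)" "g differentiable (at x)"
  shows "pd i (f + g) x = pd i f x + pd i g x"
  using frechet_derivative_at[OF has_derivative_add[OF assms[unfolded frechet_derivative_works]]]
  by (simp add: pd_def plus_fun_def fun_eq_iff)

lemma pd_scale:
  assumes "f differentiable (at x)"
  shows "pd i (r *\<^sub>R f) x = r *\<^sub>R pd i f x"
  using frechet_derivative_at[OF has_derivative_scaleR_right[OF assms[unfolded frechet_derivative_works]]]
  by (simp add: pd_def scaleR_fun_def fun_eq_iff)

lemma grad_add:
  assumes "f differentiable (at x)" "g differentiable (at x)"
  shows "grad (f + g) x = grad f x + grad g x"
  using assms by (simp add: grad_def pd_add vec_eq_iff)

lemma grad_scale: "f differentiable (at x) \<Longrightarrow> grad (r *\<^sub>R f) x = r *\<^sub>R grad f x"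
  by (simp add: grad_def pd_scale vec_eq_iff)

lemma curl_add:
  assumes "f differentiable (at x)" "g differentiable (at x)"
  shows "curl (f + g) x = curl f x + curl g x"
  using assms by (simp add: curl_def pd_add vec_eq_iff forall_3)

lemma curl_scale: "f differentiable (at x) \<Longrightarrow> curl (r *\<^sub>R f) x = r *\<^sub>R curl f x"
  by (simp add: curl_def pd_scale vec_eq_iff forall_3 algebra_simps)

section \<open>Spaces of functions vanishing on the boundary\<close>

lemma test_functions_differentiable:
  "\<phi> \<in> test_functions \<Omega> \<Longrightarrow> \<phi> differentiable (at x)"
  by (auto simp: test_functions_def differentiable_on_def dest: spec[of _ "Suc 0"])

lemma test_functions_pd_continuous:
  "\<phi> \<in> test_functions \<Omega> \<Longrightarrow> continuous_on UNIV (pd i \<phi>)"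
  by (auto simp: test_functions_def dest: spec[of _ "Suc 0"])

lemma test_functions_continuous:
  "\<phi> \<in> test_functions \<Omega> \<Longrightarrow> continuous_on UNIV \<phi>"
  by (auto simp: test_functions_def dest: spec[of _ "0"])

lemma Ck_add: "Ck k f \<Longrightarrow> Ck k g \<Longrightarrow> Ck k (f + g)"
proof (induction k arbitrary: f g)
  case 0
  then show ?case by (simp add: plus_fun_def continuous_on_add)
next
  case (Suc k)
  then have "pd i (f + g) = pd i f + pd i g" for i
    by (auto simp: fun_eq_iff differentiable_on_def pd_add)
  then show ?case using Suc by (simp add: plus_fun_def differentiable_on_add)
qed

lemma Ck_scale: "Ck k f \<Longrightarrow> Ck k (r *\<^sub>R f)"
proof (induction k arbitrary: f)
  case 0
  then show ?case by (simp add: scaleR_fun_def continuous_on_scaleR)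
next
  case (Suc k)
  then have "pd i (r *\<^sub>R f) = r *\<^sub>R pd i f" for i
    by (auto simp: fun_eq_iff differentiable_on_def pd_scale)
  then show ?case using Suc by (auto simp: scaleR_fun_def differentiable_on_def)
qed

lemma Ck_zero: "Ck k (0 :: real^3 \<Rightarrow> 'b::real_normed_vector)"
proof (induction k)
  case (Suc k)
  have "pd i (0 :: real^3 \<Rightarrow> 'b) = 0" for i
    by (simp add: fun_eq_iff pd_def zero_fun_def)
  moreover have "(0 :: real^3 \<Rightarrow> 'b) differentiable_on UNIV" by (simp add: zero_fun_def)
  ultimately show ?case by (metis Ck.simps(2) Suc.IH)
qed (simp add: zero_fun_def)

lemma subspace_test_functions:
  "subspace (test_functions \<Omega> :: (real^3 \<Rightarrow> 'b::real_normed_vector) set)"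
  unfolding subspace_def
proof (intro conjI ballI allI)
  show "0 \<in> (test_functions \<Omega> :: (real^3 \<Rightarrow> 'b) set)"
    using compact_empty by (auto simp: test_functions_def Ck_zero)
next
  fix f g :: "real^3 \<Rightarrow> 'b" assume fg: "f \<in> test_functions \<Omega>" "g \<in> test_functions \<Omega>"
  then obtain K L where "compact K" "K \<subseteq> \<Omega>" "\<forall>x. x \<notin> K \<longrightarrow> f x = 0"
    "compact L" "L \<subseteq> \<Omega>" "\<forall>x. x \<notin> L \<longrightarrow> g x = 0"
    by (auto simp: test_functions_def)
  then have "\<exists>K. compact K \<and> K \<subseteq> \<Omega> \<and> (\<forall>x. x \<notin> K \<longrightarrow> (f + g) x = 0)"
    by (intro exI[of _ "K \<union> L"]) auto
  then show "f + g \<in> test_functions \<Omega>" using fg by (auto simp: test_functions_def Ck_add)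
next
  fix r and f :: "real^3 \<Rightarrow> 'b" assume "f \<in> test_functions \<Omega>"
  then show "r *\<^sub>R f \<in> test_functions \<Omega>"
    by (auto simp: test_functions_def Ck_scale)
qed

lemma L2_limit_add:
  fixes f g :: "nat \<Rightarrow> real^3 \<Rightarrow> 'b::euclidean_space"
  assumes "(\<lambda>n. L2_norm \<Omega> (f n - f')) \<longlonglongrightarrow> 0" "(\<lambda>n. L2_norm \<Omega> (g n - g')) \<longlonglongrightarrow> 0"
    and "\<And>n. f n \<in> L2 \<Omega>" "\<And>n. g n \<in> L2 \<Omega>" "f' \<in> L2 \<Omega>" "g' \<in> L2 \<Omega>"
  shows "(\<lambda>n. L2_norm \<Omega> (f n + g n - (f' + g'))) \<longlonglongrightarrow> 0"
proof (rule tendsto_sandwich)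
  have "L2_norm \<Omega> (f n + g n - (f' + g')) \<le> L2_norm \<Omega> (f n - f') + L2_norm \<Omega> (g n - g')" for n
    using L2.triangle[of "f n - f'" \<Omega> "g n - g'"] assms(3-)
    by (simp add: L2_norm_def add_diff_add)
  then show "\<forall>\<^sub>F n in sequentially.
      L2_norm \<Omega> (f n + g n - (f' + g')) \<le> L2_norm \<Omega> (f n - f') + L2_norm \<Omega> (g n - g')"
    by simp
  show "\<forall>\<^sub>F n in sequentially. 0 \<le> L2_norm \<Omega> (f n + g n - (f' + g'))"
    using assms(3-) by (intro always_eventually allI) (auto simp: L2_norm_def intro!: L2.nonneg)
  show "(\<lambda>n. L2_norm \<Omega> (f n - f') + L2_norm \<Omega> (g n - g')) \<longlonglongrightarrow> 0"
    using tendsto_add[OF assms(1,2)] by simp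
qed auto

lemma L2_limit_scale:
  fixes f :: "nat \<Rightarrow> real^3 \<Rightarrow> 'b::euclidean_space"
  assumes "(\<lambda>n. L2_norm \<Omega> (f n - f')) \<longlonglongrightarrow> 0"
    and "\<And>n. f n \<in> L2 \<Omega>" "f' \<in> L2 \<Omega>"
  shows "(\<lambda>n. L2_norm \<Omega> (r *\<^sub>R f n - r *\<^sub>R f')) \<longlonglongrightarrow> 0"
proof -
  have "L2_norm \<Omega> (r *\<^sub>R f n - r *\<^sub>R f') = \<bar>r\<bar> * L2_norm \<Omega> (f n - f')" for n
    using L2.length_scale[of "f n - f'" \<Omega> r] assms(2,3)
    by (simp add: L2_norm_def scaleR_diff_right)
  then show ?thesis using tendsto_mult_left[OF assms(1), of "\<bar>r\<bar>"] by simp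
qed

text \<open>Sums and multiples of approximating sequences approximate the sums and multiples of the limits, by
  the triangle inequality in \<open>L\<^sup>2\<close>. For this the test functions and their derivatives have to be
  square-integrable, which they are as continuous functions on a bounded domain.\<close>

lemma subspace_H0:
  fixes D :: "(real^3 \<Rightarrow> 'b::euclidean_space) \<Rightarrow> real^3 \<Rightarrow> 'c::euclidean_space"
  assumes \<Omega>: "open \<Omega>" "bounded \<Omega>"
    and D_add: "\<And>\<phi> \<psi>. \<phi> \<in> test_functions \<Omega> \<Longrightarrow> \<psi> \<in> test_functions \<Omega> \<Longrightarrow> D (\<phi> + \<psi>) = D \<phi> + D \<psi>"
    and D_scale: "\<And>\<phi> r. \<phi> \<in> test_functions \<Omega> \<Longrightarrow> D (r *\<^sub>R \<phi>) = r *\<^sub>R D \<phi>"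
    and D_cont: "\<And>\<phi>. \<phi> \<in> test_functions \<Omega> \<Longrightarrow> continuous_on UNIV (D \<phi>)"
  shows "subspace (H0 D \<Omega>)"
proof -
  note test = subspace_test_functions[where ?'b = 'b, of \<Omega>]
  have L2: "\<phi> \<in> L2 \<Omega>" "D \<phi> \<in> L2 \<Omega>" if "\<phi> \<in> test_functions \<Omega>" for \<phi>
    using that \<Omega> D_cont test_functions_continuous continuous_imp_L2 by blast+
  show ?thesis
    unfolding subspace_def
  proof (intro conjI ballI allI)
    have "D 0 = 0" using D_scale[OF subspace_0[OF test], of 0] by simp
    then show "0 \<in> H0 D \<Omega>"
      using subspace_0[OF test]
      by (auto simp: H0_def L2_norm_def intro!: exI[of _ "\<lambda>_. 0"] exI[of _ 0])
  next
    fix f g assume "f \<in> H0 D \<Omega>" "g \<in> H0 D \<Omega>"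
    then obtain \<phi> f' \<psi> g' where
      f: "f \<in> L2 \<Omega>" "f' \<in> L2 \<Omega>" "\<And>n. \<phi> n \<in> test_functions \<Omega>"
        "(\<lambda>n. L2_norm \<Omega> (\<phi> n - f)) \<longlonglongrightarrow> 0" "(\<lambda>n. L2_norm \<Omega> (D (\<phi> n) - f')) \<longlonglongrightarrow> 0" and
      g: "g \<in> L2 \<Omega>" "g' \<in> L2 \<Omega>" "\<And>n. \<psi> n \<in> test_functions \<Omega>"
        "(\<lambda>n. L2_norm \<Omega> (\<psi> n - g)) \<longlonglongrightarrow> 0" "(\<lambda>n. L2_norm \<Omega> (D (\<psi> n) - g')) \<longlonglongrightarrow> 0"
      unfolding H0_def by blast
    have "(\<lambda>n. L2_norm \<Omega> (\<phi> n + \<psi> n - (f + g))) \<longlonglongrightarrow> 0"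
      "(\<lambda>n. L2_norm \<Omega> (D (\<phi> n + \<psi> n) - (f' + g'))) \<longlonglongrightarrow> 0"
      using f g L2 by (auto simp: D_add intro!: L2_limit_add)
    moreover have "\<forall>n. \<phi> n + \<psi> n \<in> test_functions \<Omega>" using f g subspace_add[OF test] by blast
    moreover have "f + g \<in> L2 \<Omega>" "f' + g' \<in> L2 \<Omega>" using f g by simp_all
    ultimately show "f + g \<in> H0 D \<Omega>"
      unfolding H0_def by (intro CollectI conjI exI[of _ "\<lambda>n. \<phi> n + \<psi> n"] exI[of _ "f' + g'"])
  next
    fix r f assume "f \<in> H0 D \<Omega>"
    then obtain \<phi> f' where
      f: "f \<in> L2 \<Omega>" "f' \<in> L2 \<Omega>" "\<And>n. \<phi> n \<in> test_functions \<Omega>"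
        "(\<lambda>n. L2_norm \<Omega> (\<phi> n - f)) \<longlonglongrightarrow> 0" "(\<lambda>n. L2_norm \<Omega> (D (\<phi> n) - f')) \<longlonglongrightarrow> 0"
      unfolding H0_def by blast
    have "(\<lambda>n. L2_norm \<Omega> (r *\<^sub>R \<phi> n - r *\<^sub>R f)) \<longlonglongrightarrow> 0"
      "(\<lambda>n. L2_norm \<Omega> (D (r *\<^sub>R \<phi> n) - r *\<^sub>R f')) \<longlonglongrightarrow> 0"
      using f L2 by (auto simp: D_scale intro!: L2_limit_scale)
    moreover have "\<forall>n. r *\<^sub>R \<phi> n \<in> test_functions \<Omega>" using f subspace_scale[OF test] by blast
    moreover have "r *\<^sub>R f \<in> L2 \<Omega>" "r *\<^sub>R f' \<in> L2 \<Omega>" using f by simp_all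
    ultimately show "r *\<^sub>R f \<in> H0 D \<Omega>"
      unfolding H0_def by (intro CollectI conjI exI[of _ "\<lambda>n. r *\<^sub>R \<phi> n"] exI[of _ "r *\<^sub>R f'"])
  qed
qed

lemma subspace_H1_0:
  assumes "open \<Omega>" "bounded \<Omega>"
  shows "subspace (H1_0 \<Omega>)"
proof (rule subspace_H0[OF assms])
  show "continuous_on UNIV (grad \<phi>)" if "\<phi> \<in> test_functions \<Omega>" for \<phi>
    using test_functions_pd_continuous[OF that]
    by (auto simp: grad_def[abs_def] intro!: continuous_on_vec_lambda)
qed (auto simp: fun_eq_iff grad_add grad_scale test_functions_differentiable)

lemma subspace_H0_curl:
  assumes "open \<Omega>" "bounded \<Omega>"
  shows "subspace (H0_curl \<Omega>)"
proof (rule subspace_H0[OF assms])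
  show "continuous_on UNIV (curl \<phi>)" if "\<phi> \<in> test_functions \<Omega>" for \<phi>
  proof -
    have "continuous_on UNIV (\<lambda>x. curl \<phi> x $ i)" for i
      using exhaust_3[of i]
      by (elim disjE; simp add: curl_def; intro continuous_intros test_functions_pd_continuous[OF that])
    then have "continuous_on UNIV (\<lambda>x. \<chi> i. curl \<phi> x $ i)"
      by (rule continuous_on_vec_lambda)
    then show ?thesis by simp
  qed
qed (auto simp: fun_eq_iff curl_add curl_scale test_functions_differentiable)

section \<open>Finite-dimensional subspaces\<close>

lemma finite_dim_subspace:
  assumes "subspace X" "X \<subseteq> span C" "finite C"
  shows "\<exists>B. finite B \<and> B \<subseteq> X \<and> X = span B"
proof -
  obtain B where B: "B \<subseteq> X" "independent B" "X \<subseteq> span B"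
    using maximal_independent_subset by blast
  then have "finite B" using independent_span_bound[of C B] assms by blast
  moreover have "span B \<subseteq> X" using B assms by (simp add: span_minimal)
  ultimately show ?thesis using B by blast
qed

text \<open>Applied to the gradient, this derives the finite dimension of the Lagrange space from that of the
  edge space. A finite spanning set of the image is pulled back; the preimages span \<open>X\<close> because \<open>f\<close> is
  injective. The cellwise gradient is linear only on \<open>X\<close>, not on the whole type of functions, hence
  the relativized assumptions.\<close>

lemma finite_dim_injective:
  assumes X: "subspace X" and f_range: "f ` X \<subseteq> span C" and fin: "finite C"
    and add: "\<And>x y. x \<in> X \<Longrightarrow> y \<in> X \<Longrightarrow> f (x + y) = f x + f y"
    and scale: "\<And>x r. x \<in> X \<Longrightarrow> f (r *\<^sub>R x) = r *\<^sub>R f x"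
    and inj: "\<And>x. x \<in> X \<Longrightarrow> f x = 0 \<Longrightarrow> x = 0"
  shows "\<exists>B. finite B \<and> X = span B"
proof -
  have f0: "f 0 = 0" using scale[of 0 0] X by (simp add: subspace_0)
  have image: "subspace (f ` Y)" if "subspace Y" "Y \<subseteq> X" for Y
    unfolding subspace_def
  proof (intro conjI ballI allI)
    show "0 \<in> f ` Y" using f0 that by (metis imageI subspace_0)
    show "u + v \<in> f ` Y" if "u \<in> f ` Y" "v \<in> f ` Y" for u v
      using that \<open>subspace Y\<close> \<open>Y \<subseteq> X\<close> by (auto simp: image_iff) (metis add subsetD subspace_add)
    show "r *\<^sub>R u \<in> f ` Y" if "u \<in> f ` Y" for r u
      using that \<open>subspace Y\<close> \<open>Y \<subseteq> X\<close> by (auto simp: image_iff) (metis scale subsetD subspace_scale)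
  qed
  obtain E where E: "finite E" "E \<subseteq> f ` X" "f ` X = span E"
    using finite_dim_subspace[OF image f_range fin] X by blast
  obtain F where F: "finite F" "F \<subseteq> X" "E = f ` F"
    using finite_subset_image E by metis
  have FX: "span F \<subseteq> X" using F X by (simp add: span_minimal)
  have span: "span E \<subseteq> f ` span F"
    using F FX by (intro span_minimal[of E] image subspace_span) (auto simp: span_base)
  have "x \<in> span F" if x: "x \<in> X" for x
  proof -
    obtain y where y: "y \<in> span F" "f x = f y" using x E span by blast
    have "f x = f (x - y) + f y" using add[of "x - y" y] x y FX X by (auto simp: subspace_diff)
    then have "x - y = 0" using inj[of "x - y"] x y FX X by (auto simp: subspace_diff)
    then show ?thesis using y by simp
  qed
  then show ?thesis using F FX by blast
qed

lemma semi_inner_on_pullback: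
  assumes "semi_inner_on Y b" "subspace X" "\<And>x. x \<in> X \<Longrightarrow> f x \<in> Y"
    and "\<And>x y. x \<in> X \<Longrightarrow> y \<in> X \<Longrightarrow> f (x + y) = f x + f y"
    and "\<And>x r. x \<in> X \<Longrightarrow> f (r *\<^sub>R x) = r *\<^sub>R f x"
  shows "semi_inner_on X (\<lambda>x y. b (f x) (f y))"
proof -
  interpret semi_inner_on Y b by fact
  show ?thesis
    by standard (use assms(2-) in \<open>auto simp: expand nonneg intro: sym\<close>)
qed

section \<open>Polynomial shape functions\<close>

definition monomials :: "nat \<Rightarrow> (real^3 \<Rightarrow> real) set"
  where "monomials k = {\<lambda>x. \<Prod>i\<in>UNIV. (x $ i) ^ \<alpha> i | \<alpha>. (\<Sum>i\<in>UNIV. \<alpha> i) \<le> k}"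

lemma Poly_eq: "Poly k = span (monomials k)"
  by (simp add: Poly_def monomials_def)

lemma subspace_Poly: "subspace (Poly k)"
  by (simp add: Poly_eq)

lemma finite_monomials: "finite (monomials k)"
proof -
  have "finite {\<alpha> :: 3 \<Rightarrow> nat. \<forall>i. (i \<in> UNIV \<longrightarrow> \<alpha> i \<in> {..k}) \<and> (i \<notin> UNIV \<longrightarrow> \<alpha> i = 0)}"
    by (rule finite_set_of_finite_funs) auto
  then have "finite {\<alpha> :: 3 \<Rightarrow> nat. (\<Sum>i\<in>UNIV. \<alpha> i) \<le> k}"
  proof (rule rev_finite_subset, intro subsetI CollectI allI conjI impI)
    fix \<alpha> :: "3 \<Rightarrow> nat" and i :: 3 assume "\<alpha> \<in> {\<alpha>. (\<Sum>i\<in>UNIV. \<alpha> i) \<le> k}"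
    then show "\<alpha> i \<in> {..k}" using member_le_sum[of i UNIV \<alpha>] by simp
  qed auto
  moreover have "monomials k = (\<lambda>\<alpha> x. \<Prod>i\<in>UNIV. (x $ i) ^ \<alpha> i) ` {\<alpha>. (\<Sum>i\<in>UNIV. \<alpha> i) \<le> k}"
    by (auto simp: monomials_def)
  ultimately show ?thesis by simp
qed

lemma Poly_mono: "j \<le> k \<Longrightarrow> Poly j \<subseteq> Poly k"
  unfolding Poly_eq monomials_def using order_trans by (intro span_mono) blast

lemma Poly_times_coordinate:
  assumes "q \<in> Poly k"
  shows "(\<lambda>x. x $ j * q x) \<in> Poly (Suc k)"
proof -
  have "monomials k \<subseteq> {q. (\<lambda>x. x $ j * q x) \<in> Poly (Suc k)}"
  proof
    fix q assume "q \<in> monomials k"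
    then obtain \<alpha> where \<alpha>: "q = (\<lambda>x. \<Prod>i\<in>UNIV. (x $ i) ^ \<alpha> i)" "(\<Sum>i\<in>UNIV. \<alpha> i) \<le> k"
      by (auto simp: monomials_def)
    let ?\<beta> = "\<lambda>i. \<alpha> i + (if i = j then 1 else 0)"
    have "(\<Prod>i\<in>UNIV. (x $ i) ^ ?\<beta> i) = x $ j * q x" for x :: "real^3"
    proof -
      have "(\<Prod>i\<in>UNIV. (x $ i) ^ ?\<beta> i)
          = (\<Prod>i\<in>UNIV. (x $ i) ^ \<alpha> i) * (\<Prod>i\<in>UNIV. if i = j then x $ i else 1)"
        unfolding prod.distrib[symmetric] by (rule prod.cong) auto
      then show ?thesis by (simp add: \<alpha>)
    qed
    moreover have "(\<Sum>i\<in>UNIV. ?\<beta> i) \<le> Suc k" using \<alpha> by (simp add: sum.distrib)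
    ultimately have "(\<lambda>x. x $ j * q x) \<in> monomials (Suc k)"
      unfolding monomials_def by (intro CollectI exI[of _ ?\<beta>]) auto
    then show "q \<in> {q. (\<lambda>x. x $ j * q x) \<in> Poly (Suc k)}" by (simp add: Poly_eq span_base)
  qed
  moreover have "subspace {q. (\<lambda>x. x $ j * q x) \<in> Poly (Suc k)}"
  proof -
    have "(\<lambda>x. x $ j * (p + q) x) = (\<lambda>x. x $ j * p x) + (\<lambda>x. x $ j * q x)"
      "(\<lambda>x. x $ j * (r *\<^sub>R p) x) = r *\<^sub>R (\<lambda>x. x $ j * p x)"
      "(\<lambda>x. x $ j * (0 :: real^3 \<Rightarrow> real) x) = 0" for p q :: "real^3 \<Rightarrow> real" and r
      by (auto simp: fun_eq_iff algebra_simps)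
    then show ?thesis
      using subspace_Poly[of "Suc k"] unfolding subspace_def by auto
  qed
  ultimately show ?thesis using assms span_minimal unfolding Poly_eq by blast
qed

lemma subspace_VPoly: "subspace (VPoly k)"
proof -
  have "(\<lambda>x. (a + b) x $ i) = (\<lambda>x. a x $ i) + (\<lambda>x. b x $ i)"
    "(\<lambda>x. (r *\<^sub>R a) x $ i) = r *\<^sub>R (\<lambda>x. a x $ i)"
    "(\<lambda>x. (0 :: real^3 \<Rightarrow> real^3) x $ i) = 0" for a b :: "real^3 \<Rightarrow> real^3" and i r
    by (auto simp: fun_eq_iff)
  then show ?thesis
    using subspace_Poly[of k] unfolding subspace_def VPoly_def by auto
qed

definition vector_monomials :: "nat \<Rightarrow> (real^3 \<Rightarrow> real^3) set"
  where "vector_monomials k = (\<lambda>(q, i) x. q x *\<^sub>R axis i 1) ` (monomials k \<times> UNIV)"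

lemma finite_vector_monomials: "finite (vector_monomials k)"
  by (simp add: vector_monomials_def finite_monomials)

text \<open>A vector field is the sum of its three components times the unit vectors.\<close>

lemma VPoly_subset_span: "VPoly k \<subseteq> span (vector_monomials k)"
proof
  fix a assume a: "a \<in> VPoly k"
  have "Poly k \<subseteq> {q. (\<lambda>x. q x *\<^sub>R axis i 1) \<in> span (vector_monomials k)}" for i
    unfolding Poly_eq
  proof (rule span_minimal)
    show "monomials k \<subseteq> {q. (\<lambda>x. q x *\<^sub>R axis i 1) \<in> span (vector_monomials k)}"
      by (auto simp: vector_monomials_def intro!: span_base image_eqI)
    have "(\<lambda>x. (p + q) x *\<^sub>R (axis i 1 :: real^3)) = (\<lambda>x. p x *\<^sub>R axis i 1) + (\<lambda>x. q x *\<^sub>R axis i 1)"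
      "(\<lambda>x. (r *\<^sub>R p) x *\<^sub>R (axis i 1 :: real^3)) = r *\<^sub>R (\<lambda>x. p x *\<^sub>R axis i 1)"
      "(\<lambda>x. (0 :: real^3 \<Rightarrow> real) x *\<^sub>R (axis i 1 :: real^3)) = 0" for p q :: "real^3 \<Rightarrow> real" and r
      by (auto simp: fun_eq_iff algebra_simps)
    then show "subspace {q. (\<lambda>x. q x *\<^sub>R axis i 1) \<in> span (vector_monomials k)}"
      using subspace_span[of "vector_monomials k"] unfolding subspace_def by auto
  qed
  then have comp: "(\<lambda>x. a x $ i *\<^sub>R axis i 1) \<in> span (vector_monomials k)" for i
    using a by (auto simp: VPoly_def)
  have "a = (\<lambda>x. a x $ 1 *\<^sub>R axis 1 1) + (\<lambda>x. a x $ 2 *\<^sub>R axis 2 1) + (\<lambda>x. a x $ 3 *\<^sub>R axis 3 1)"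
    by (auto simp: fun_eq_iff vec_eq_iff forall_3 axis_def)
  then show "a \<in> span (vector_monomials k)"
    using comp by (metis span_add)
qed

lemma subspace_differentiable:
  "subspace {f :: real^3 \<Rightarrow> 'b::real_normed_vector. \<forall>x. f differentiable (at x)}"
  unfolding subspace_def plus_fun_def zero_fun_def scaleR_fun_def
  by (simp add: differentiable_add differentiable_scaleR)

lemma monomial_differentiable:
  "(\<lambda>x :: real^3. \<Prod>i\<in>UNIV. (x $ i) ^ \<alpha> i) differentiable (at x)"
proof -
  have coordinate: "(\<lambda>x :: real^3. x $ i) differentiable (at x)" for i
    by (rule bounded_linear_imp_differentiable) (rule bounded_linear_vec_nth)
  have "(\<lambda>x :: real^3. (x $ 1) ^ \<alpha> 1 * ((x $ 2) ^ \<alpha> 2 * (x $ 3) ^ \<alpha> 3)) differentiable (at x)"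
    by (intro differentiable_mult differentiable_power coordinate)
  moreover have "(\<Prod>i\<in>UNIV. f i) = f 1 * (f 2 * f 3)" for f :: "3 \<Rightarrow> real"
    unfolding UNIV_3 by simp
  ultimately show ?thesis by simp
qed

lemma Poly_differentiable: "q \<in> Poly k \<Longrightarrow> q differentiable (at x)"
proof -
  have "Poly k \<subseteq> {f. \<forall>x. f differentiable (at x)}"
    unfolding Poly_eq
    by (rule span_minimal[OF _ subspace_differentiable])
      (auto simp: monomials_def monomial_differentiable)
  then show "q \<in> Poly k \<Longrightarrow> q differentiable (at x)" by auto
qed

lemma VPoly_differentiable: "a \<in> VPoly k \<Longrightarrow> a differentiable (at x)"
proof -
  have "span (vector_monomials k) \<subseteq> {f. \<forall>x. f differentiable (at x)}"
    by (rule span_minimal[OF _ subspace_differentiable])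
      (auto simp: vector_monomials_def monomials_def monomial_differentiable)
  then show "a \<in> VPoly k \<Longrightarrow> a differentiable (at x)" using VPoly_subset_span by auto
qed

lemma VPoly_mono: "j \<le> k \<Longrightarrow> VPoly j \<subseteq> VPoly k"
  using Poly_mono by (auto simp: VPoly_def)

lemma VPoly_cross3:
  assumes "b \<in> VPoly k"
  shows "(\<lambda>x. cross3 x (b x)) \<in> VPoly (Suc k)"
proof -
  have "(\<lambda>x. x $ i * b x $ j) - (\<lambda>x. x $ i' * b x $ j') \<in> Poly (Suc k)" for i j i' j'
    using assms by (intro subspace_diff subspace_Poly) (auto simp: VPoly_def intro: Poly_times_coordinate)
  then have "(\<lambda>x. x $ i * b x $ j - x $ i' * b x $ j') \<in> Poly (Suc k)" for i j i' j'
    by (simp add: fun_diff_def)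
  then show ?thesis by (simp add: VPoly_def forall_3 cross3_def)
qed

lemma VPoly_radial: "b \<in> Poly k \<Longrightarrow> (\<lambda>x. b x *\<^sub>R x) \<in> VPoly (Suc k)"
  using Poly_times_coordinate by (simp add: VPoly_def mult.commute)

text \<open>Finite dimension and smoothness of the shape functions are inherited from a space of vector
  polynomials of sufficiently high degree that contains them.\<close>

lemma edge_shape_VPoly: "\<exists>n. edge_shape e \<subseteq> VPoly n"
proof (cases e)
  case (First_Kind k)
  have "a + (\<lambda>x. cross3 x (b x)) \<in> VPoly (Suc k)" if "a \<in> VPoly k" "b \<in> VPoly k" for a b
    using that VPoly_mono[of k "Suc k"] by (intro subspace_add[OF subspace_VPoly] VPoly_cross3) auto
  then show ?thesis using First_Kind by (intro exI[of _ "Suc k"]) (auto simp: plus_fun_def)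
qed auto

lemma face_shape_VPoly: "\<exists>n. face_shape e \<subseteq> VPoly n"
proof (cases e)
  case (First_Kind k)
  have "a + (\<lambda>x. b x *\<^sub>R x) \<in> VPoly (Suc k)" if "a \<in> VPoly k" "b \<in> Poly k" for a b
    using that VPoly_mono[of k "Suc k"] by (intro subspace_add[OF subspace_VPoly] VPoly_radial) auto
  then show ?thesis using First_Kind by (intro exI[of _ "Suc k"]) (auto simp: plus_fun_def)
qed auto

lemma subspace_edge_shape: "subspace (edge_shape e)"
proof (cases e)
  case (First_Kind k)
  define f where "f = (\<lambda>(a, b) (x :: real^3). a x + cross3 x (b x))"
  have "linear f"
    by (rule linearI) (auto simp: f_def fun_eq_iff cross_add_right cross_mult_right algebra_simps)
  moreover have "edge_shape e = f ` (VPoly k \<times> VPoly k)"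
    by (auto simp: First_Kind f_def)
  ultimately show ?thesis
    by (simp add: linear_subspace_image subspace_Times subspace_VPoly)
qed (simp add: subspace_VPoly)

section \<open>Piecewise smooth functions on a mesh\<close>

text \<open>The intersection of two cells is a face of each; a face that meets the interior is the whole cell.\<close>

lemma mesh_interiors_disjoint:
  assumes mesh: "tetrahedral_mesh \<Omega> \<T>" and KL: "K \<in> \<T>" "L \<in> \<T>"
    and x: "x \<in> interior K" "x \<in> interior L"
  shows "K = L"
proof -
  have "\<forall>T T'. T \<in> \<T> \<and> T' \<in> \<T> \<longrightarrow> (T \<inter> T') face_of T"
    using mesh by (simp add: tetrahedral_mesh_def triangulation_def)
  then have face: "(K \<inter> L) face_of K" "(K \<inter> L) face_of L"
    using KL by (metis, metis Int_commute)
  have "K \<inter> L = K" using face_of_disjoint_interior[OF face(1)] x interior_subset by blast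
  moreover have "K \<inter> L = L" using face_of_disjoint_interior[OF face(2)] x interior_subset by blast
  ultimately show ?thesis by simp
qed

lemma mesh_finite: "tetrahedral_mesh \<Omega> \<T> \<Longrightarrow> finite \<T>"
  by (simp add: tetrahedral_mesh_def triangulation_def)

text \<open>An open convex set is the interior of its closure, and the cells lie in the closure of \<open>\<Omega>\<close>.\<close>

lemma skeleton_compl_subset:
  assumes "convex_polyhedral_domain \<Omega>" "tetrahedral_mesh \<Omega> \<T>"
  shows "skeleton_compl \<T> \<subseteq> \<Omega>"
proof -
  have "interior K \<subseteq> \<Omega>" if "K \<in> \<T>" for K
  proof -
    have "K \<subseteq> closure \<Omega>" using assms that by (auto simp: tetrahedral_mesh_def)
    then have "interior K \<subseteq> interior (closure \<Omega>)" by (rule interior_mono)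
    also have "\<dots> = \<Omega>"
      using assms by (simp add: convex_polyhedral_domain_def convex_interior_closure interior_open)
    finally show ?thesis .
  qed
  then show ?thesis by (auto simp: skeleton_compl_def)
qed

lemma subspace_broken:
  assumes P: "subspace P"
  shows "subspace (broken \<T> P)"
  unfolding subspace_def
proof (intro conjI ballI allI)
  show "0 \<in> broken \<T> P"
    using subspace_0[OF P] by (auto simp: broken_def intro!: bexI[of _ 0])
next
  fix u v assume u: "u \<in> broken \<T> P" and v: "v \<in> broken \<T> P"
  have "\<exists>q\<in>P. \<forall>x\<in>interior K. (u + v) x = q x" if K: "K \<in> \<T>" for K
  proof -
    obtain p where p: "p \<in> P" "\<forall>x\<in>interior K. u x = p x" using u K by (auto simp: broken_def)
    obtain q where q: "q \<in> P" "\<forall>x\<in>interior K. v x = q x" using v K by (auto simp: broken_def)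
    show ?thesis using p q subspace_add[OF P] by (intro bexI[of _ "p + q"]) auto
  qed
  then show "u + v \<in> broken \<T> P" using u v by (auto simp: broken_def)
next
  fix r u assume u: "u \<in> broken \<T> P"
  have "\<exists>q\<in>P. \<forall>x\<in>interior K. (r *\<^sub>R u) x = q x" if K: "K \<in> \<T>" for K
  proof -
    obtain p where p: "p \<in> P" "\<forall>x\<in>interior K. u x = p x" using u K by (auto simp: broken_def)
    show ?thesis using p subspace_scale[OF P] by (intro bexI[of _ "r *\<^sub>R p"]) auto
  qed
  then show "r *\<^sub>R u \<in> broken \<T> P" using u by (auto simp: broken_def)
qed

lemma sum_fun_apply: "(\<Sum>i\<in>I. f i) x = (\<Sum>i\<in>I. f i x)"
  for f :: "'i \<Rightarrow> 'a \<Rightarrow> 'b::comm_monoid_add"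
  by (induction I rule: infinite_finite_induct) auto

text \<open>A piecewise function is the sum over the cells of its pieces, each cut off outside its open cell;
  this sum has at most one nonzero term at each point because the open cells are disjoint.\<close>

lemma broken_finite_dim:
  fixes P :: "(real^3 \<Rightarrow> 'b::real_vector) set"
  assumes mesh: "tetrahedral_mesh \<Omega> \<T>" and B: "finite B" "P \<subseteq> span B"
  shows "\<exists>C. finite C \<and> broken \<T> P \<subseteq> span C"
proof -
  define cut where "cut = (\<lambda>K (f :: real^3 \<Rightarrow> 'b) x. indicator (interior K) x *\<^sub>R f x)"
  define C where "C = (\<lambda>(K, f). cut K f) ` (\<T> \<times> B)"
  have cut: "cut K q \<in> span C" if K: "K \<in> \<T>" and q: "q \<in> P" for K q
  proof -
    have "linear (cut K)"
      by (rule linearI) (auto simp: cut_def fun_eq_iff algebra_simps)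
    then have "cut K ` span B \<subseteq> span (cut K ` B)" by (simp add: linear_span_image)
    also have "\<dots> \<subseteq> span C" by (rule span_mono) (use K in \<open>auto simp: C_def\<close>)
    finally show ?thesis using B q by blast
  qed
  have "broken \<T> P \<subseteq> span C"
  proof
    fix u assume u: "u \<in> broken \<T> P"
    then obtain q where q: "\<And>K. K \<in> \<T> \<Longrightarrow> q K \<in> P"
      "\<And>K x. K \<in> \<T> \<Longrightarrow> x \<in> interior K \<Longrightarrow> u x = q K x"
      by (auto simp: broken_def) metis
    have "u x = (\<Sum>K\<in>\<T>. cut K (q K) x)" for x
    proof (cases "x \<in> skeleton_compl \<T>")
      case True
      then obtain L where L: "L \<in> \<T>" "x \<in> interior L" by (auto simp: skeleton_compl_def)
      have "(\<Sum>K\<in>\<T>. cut K (q K) x) = (\<Sum>K\<in>\<T>. if K = L then q L x else 0)"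
        using mesh_interiors_disjoint[OF mesh] L
        by (intro sum.cong) (auto simp: cut_def indicator_def)
      then show ?thesis using L q mesh_finite[OF mesh] by simp
    next
      case False
      then have "cut K (q K) x = 0" if "K \<in> \<T>" for K
        using that by (auto simp: cut_def skeleton_compl_def indicator_def)
      moreover have "u x = 0" using u False by (simp add: broken_def)
      ultimately show ?thesis by simp
    qed
    then have "u = (\<Sum>K\<in>\<T>. cut K (q K))" by (simp add: fun_eq_iff sum_fun_apply)
    then show "u \<in> span C" using cut q by (simp add: span_sum)
  qed
  moreover have "finite C" using B mesh_finite[OF mesh] by (simp add: C_def)
  ultimately show ?thesis by blast
qed

lemma cellwise_differentiable:
  assumes "\<forall>K\<in>\<T>. \<exists>q\<in>P. \<forall>x\<in>interior K. u x = q x"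
    and "\<And>q x. q \<in> P \<Longrightarrow> q differentiable (at x)" "x \<in> skeleton_compl \<T>"
  shows "u differentiable (at x)"
proof -
  obtain K where K: "K \<in> \<T>" "x \<in> interior K" using assms by (auto simp: skeleton_compl_def)
  then obtain q where q: "q \<in> P" "\<forall>x\<in>interior K. u x = q x" using assms by blast
  obtain q' where "(q has_derivative q') (at x)" using assms(2)[OF q(1)] by (auto simp: differentiable_def)
  then have "(u has_derivative q') (at x)"
    by (rule has_derivative_transform_within_open[OF _ open_interior K(2)]) (use q in auto)
  then show ?thesis by (auto simp: differentiable_def)
qed

text \<open>On the open cells this is a matter of continuity; off them the chosen representative is \<open>0\<close>.\<close>

lemma broken_definite:
  fixes u :: "real^3 \<Rightarrow> real^3"
  assumes "skeleton_compl \<T> \<subseteq> \<Omega>" and P: "P \<subseteq> VPoly n"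
    and u: "u \<in> L2 \<Omega>" "u \<in> broken \<T> P" "L2_inner \<Omega> u u = 0"
  shows "u = 0"
proof (rule ext)
  fix x
  show "u x = 0 x"
  proof (cases "x \<in> skeleton_compl \<T>")
    case True
    have "\<forall>K\<in>\<T>. \<exists>q\<in>P. \<forall>x\<in>interior K. u x = q x"
      using u(2) by (simp add: broken_def)
    then have "\<forall>K\<in>\<T>. \<exists>q\<in>VPoly n. \<forall>x\<in>interior K. u x = q x"
      using P by blast
    then have "isCont u y" if "y \<in> skeleton_compl \<T>" for y
      using cellwise_differentiable[OF _ VPoly_differentiable that]
      by (intro differentiable_imp_continuous_within) simp
    then have "continuous_on (skeleton_compl \<T>) u"
      by (intro continuous_at_imp_continuous_on) simp
    moreover have "open (skeleton_compl \<T>)" by (auto simp: skeleton_compl_def)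
    ultimately have "u x = 0"
      using L2_null_imp_zero[OF u(1,3)] assms(1) True by blast
    then show ?thesis by simp
  qed (use u in \<open>simp add: broken_def\<close>)
qed

section \<open>The discrete Maxwell complex\<close>

lemma subspace_Lagrange_space:
  assumes "open \<Omega>" "bounded \<Omega>"
  shows "subspace (Lagrange_space \<Omega> \<T> k)"
  unfolding subspace_def
proof (intro conjI ballI allI)
  note H = subspace_H1_0[OF assms] and P = subspace_Poly[of "Suc k"]
  show "0 \<in> Lagrange_space \<Omega> \<T> k"
    using subspace_0[OF H] subspace_0[OF P]
    by (auto simp: Lagrange_space_def zero_fun_def intro!: bexI[of _ "\<lambda>_. 0"])
  {
    fix p q assume p: "p \<in> Lagrange_space \<Omega> \<T> k" and q: "q \<in> Lagrange_space \<Omega> \<T> k"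
    have "\<exists>q'\<in>Poly (Suc k). \<forall>x\<in>K. (p + q) x = q' x" if K: "K \<in> \<T>" for K
    proof -
      obtain p' where p': "p' \<in> Poly (Suc k)" "\<forall>x\<in>K. p x = p' x"
        using p K by (auto simp: Lagrange_space_def)
      obtain q' where q': "q' \<in> Poly (Suc k)" "\<forall>x\<in>K. q x = q' x"
        using q K by (auto simp: Lagrange_space_def)
      show ?thesis using p' q' subspace_add[OF P] by (intro bexI[of _ "p' + q'"]) auto
    qed
    moreover have "continuous_on UNIV (p + q)"
      unfolding plus_fun_def using p q by (intro continuous_on_add) (auto simp: Lagrange_space_def)
    ultimately show "p + q \<in> Lagrange_space \<Omega> \<T> k"
      using p q subspace_add[OF H] by (auto simp: Lagrange_space_def)
  }
  fix r p assume p: "p \<in> Lagrange_space \<Omega> \<T> k"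
  have "\<exists>q'\<in>Poly (Suc k). \<forall>x\<in>K. (r *\<^sub>R p) x = q' x" if K: "K \<in> \<T>" for K
  proof -
    obtain p' where p': "p' \<in> Poly (Suc k)" "\<forall>x\<in>K. p x = p' x"
      using p K by (auto simp: Lagrange_space_def)
    show ?thesis using p' subspace_scale[OF P] by (intro bexI[of _ "r *\<^sub>R p'"]) auto
  qed
  moreover have "continuous_on UNIV (r *\<^sub>R p)"
    unfolding scaleR_fun_def using p by (intro continuous_intros) (auto simp: Lagrange_space_def)
  ultimately show "r *\<^sub>R p \<in> Lagrange_space \<Omega> \<T> k"
    using p subspace_scale[OF H] by (auto simp: Lagrange_space_def)
qed

text \<open>Here the functions are continuous on all of \<open>\<Omega>\<close>, and \<open>0\<close> outside by the choice of representative.\<close>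

lemma Lagrange_definite:
  assumes "open \<Omega>" "p \<in> Lagrange_space \<Omega> \<T> k" "L2_inner \<Omega> p p = 0"
  shows "p = 0"
proof (rule ext)
  fix x
  have p: "p \<in> L2 \<Omega>" "continuous_on UNIV p" "x \<notin> \<Omega> \<Longrightarrow> p x = 0"
    using assms(2) by (auto simp: Lagrange_space_def H0_def)
  then have "x \<in> \<Omega> \<Longrightarrow> p x = 0"
    using L2_null_imp_zero[OF p(1) assms(3,1) order_refl]
    by (metis continuous_on_subset subset_UNIV)
  then show "p x = 0 x" using p(3) by auto
qed

text \<open>Exactness enters in several ways: gradients lie in \<open>U\<close> and curls in \<open>V\<close>, the gradient is injective,
  and its range is the kernel of the curl. The membership of curls in \<open>V\<close> makes the curl form definite modulo
  that kernel, because it represents the curls by piecewise polynomials.\<close>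

lemma discrete_Maxwell_saddle:
  assumes domain: "convex_polyhedral_domain \<Omega>" and mesh: "tetrahedral_mesh \<Omega> \<T>"
    and S: "S = Lagrange_space \<Omega> \<T> kS" and U: "U = edge_space \<Omega> \<T> eU"
    and V: "V = face_space \<Omega> \<T> eV" and exact: "exact_complex \<T> S U V W"
  shows "regularized_saddle S (L2_inner \<Omega>) U (L2_inner \<Omega>)
    (\<lambda>u v. L2_inner \<Omega> (curl_h \<T> u) (curl_h \<T> v)) (grad_h \<T>)"
proof -
  have \<Omega>: "open \<Omega>" "bounded \<Omega>" using domain by (auto simp: convex_polyhedral_domain_def)
  note cells = skeleton_compl_subset[OF domain mesh]
  obtain nU nV where n: "edge_shape eU \<subseteq> VPoly nU" "face_shape eV \<subseteq> VPoly nV"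
    using edge_shape_VPoly face_shape_VPoly by metis
  have subS: "subspace S" unfolding S by (rule subspace_Lagrange_space[OF \<Omega>])
  have subU: "subspace U"
    unfolding U edge_space_def
    by (intro subspace_inter subspace_H0_curl \<Omega> subspace_broken subspace_edge_shape)
  have L2: "S \<subseteq> L2 \<Omega>" "U \<subseteq> L2 \<Omega>" "V \<subseteq> L2 \<Omega>"
    by (auto simp: S U V Lagrange_space_def edge_space_def face_space_def H0_def)
  have diffS: "p differentiable (at x)" if "p \<in> S" "x \<in> skeleton_compl \<T>" for p x
  proof (rule cellwise_differentiable[OF _ Poly_differentiable that(2)])
    show "\<forall>K\<in>\<T>. \<exists>q\<in>Poly (Suc kS). \<forall>x\<in>interior K. p x = q x"
      using that(1) interior_subset unfolding S Lagrange_space_def by blast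
  qed
  have diffU: "u differentiable (at x)" if "u \<in> U" "x \<in> skeleton_compl \<T>" for u x
  proof (rule cellwise_differentiable[OF _ VPoly_differentiable that(2)])
    show "\<forall>K\<in>\<T>. \<exists>q\<in>VPoly nU. \<forall>x\<in>interior K. u x = q x"
      using that(1) n(1) unfolding U edge_space_def broken_def by blast
  qed
  have grad_closed: "grad_h \<T> p \<in> U" if "p \<in> S" for p
    using exact that unfolding exact_complex_def by blast
  have curl_closed: "curl_h \<T> u \<in> V" if "u \<in> U" for u
    using exact that unfolding exact_complex_def by blast
  have grad_add: "grad_h \<T> (p + q) = grad_h \<T> p + grad_h \<T> q" if "p \<in> S" "q \<in> S" for p q
    using that by (auto simp: grad_h_def on_cells_def fun_eq_iff grad_add diffS)
  have grad_scale: "grad_h \<T> (r *\<^sub>R p) = r *\<^sub>R grad_h \<T> p" if "p \<in> S" for p r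
    using that by (auto simp: grad_h_def on_cells_def fun_eq_iff grad_scale diffS)
  have curl_add: "curl_h \<T> (u + v) = curl_h \<T> u + curl_h \<T> v" if "u \<in> U" "v \<in> U" for u v
    using that by (auto simp: curl_h_def on_cells_def fun_eq_iff curl_add diffU)
  have curl_scale: "curl_h \<T> (r *\<^sub>R u) = r *\<^sub>R curl_h \<T> u" if "u \<in> U" for u r
    using that by (auto simp: curl_h_def on_cells_def fun_eq_iff curl_scale diffU)
  have grad_inj: "p = 0" if "p \<in> S" "grad_h \<T> p = 0" for p
    using exact that unfolding exact_complex_def by blast
  have definiteU: "u = 0" if "u \<in> U" "L2_inner \<Omega> u u = 0" for u
    using broken_definite[OF cells n(1)] that L2(2) unfolding U edge_space_def by blast
  have definiteV: "v = 0" if "v \<in> V" "L2_inner \<Omega> v v = 0" for v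
    using broken_definite[OF cells n(2)] that L2(3) unfolding V face_space_def by blast
  have curl_kernel: "L2_inner \<Omega> (curl_h \<T> u) (curl_h \<T> u) = 0 \<longleftrightarrow> u \<in> grad_h \<T> ` S"
    if u: "u \<in> U" for u
  proof -
    have "L2_inner \<Omega> (curl_h \<T> u) (curl_h \<T> u) = 0 \<longleftrightarrow> curl_h \<T> u = 0"
      using definiteV[OF curl_closed[OF u]] by (metis L2.zero_closed L2.zero_left)
    then show ?thesis using exact u unfolding exact_complex_def by blast
  qed
  obtain C where C: "finite C" "U \<subseteq> span C"
    using broken_finite_dim[OF mesh finite_vector_monomials, of "edge_shape eU" nU]
      n VPoly_subset_span unfolding U edge_space_def by blast
  have fin_U: "\<exists>B. finite B \<and> U = span B" using finite_dim_subspace[OF subU C(2,1)] by blast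
  have fin_S: "\<exists>B. finite B \<and> S = span B"
  proof (rule finite_dim_injective[OF subS _ C(1) grad_add grad_scale grad_inj])
    show "grad_h \<T> ` S \<subseteq> span C" using grad_closed C(2) by blast
  qed
  interpret S: semi_inner_on S "L2_inner \<Omega>"
    by (rule semi_inner_on_pullback[OF L2.semi_inner_on_axioms subS, where f = "\<lambda>p. p"])
      (use L2 in auto)
  interpret M: inner_on S "L2_inner \<Omega>"
    by unfold_locales (use Lagrange_definite[OF \<Omega>(1)] S fin_S in blast)+
  interpret I: semi_inner_on U "L2_inner \<Omega>"
    by (rule semi_inner_on_pullback[OF L2.semi_inner_on_axioms subU, where f = "\<lambda>u. u"])
      (use L2 in auto)
  interpret C: semi_inner_on U "\<lambda>u v. L2_inner \<Omega> (curl_h \<T> u) (curl_h \<T> v)"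
    by (rule semi_inner_on_pullback[OF L2.semi_inner_on_axioms subU])
      (use L2 curl_closed curl_add curl_scale in auto)
  show ?thesis
    by unfold_locales
      (fact grad_closed grad_add grad_scale grad_inj curl_kernel definiteU fin_U)+
qed

theorem theorem4p9:
  fixes \<Omega> :: "(real^3) set" and H :: "real set" and \<T> :: "real \<Rightarrow> (real^3) set set"
    and kS kW :: nat and eU eV :: element
    and S W :: "real \<Rightarrow> (real^3 \<Rightarrow> real) set" and U V :: "real \<Rightarrow> (real^3 \<Rightarrow> real^3) set"
  assumes domain: "convex_polyhedral_domain \<Omega>"
    and mesh: "\<And>h. h \<in> H \<Longrightarrow> tetrahedral_mesh \<Omega> (\<T> h)"
    and size: "\<And>h. h \<in> H \<Longrightarrow> mesh_size (\<T> h) = h"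
    and regular: "shape_regular (\<T> ` H)"
    and uniform: "quasi_uniform (\<T> ` H)"
    and S: "\<And>h. h \<in> H \<Longrightarrow> S h = Lagrange_space \<Omega> (\<T> h) kS"
    and U: "\<And>h. h \<in> H \<Longrightarrow> U h = edge_space \<Omega> (\<T> h) eU"
    and V: "\<And>h. h \<in> H \<Longrightarrow> V h = face_space \<Omega> (\<T> h) eV"
    and W: "\<And>h. h \<in> H \<Longrightarrow> W h = DG_space \<Omega> (\<T> h) kW"
    and exact: "\<And>h. h \<in> H \<Longrightarrow> exact_complex (\<T> h) (S h) (U h) (V h) (W h)"
  shows "\<exists>c1>0. \<exists>c2>0. \<exists>\<kappa>>0. \<forall>h\<in>H.
    (let X = U h \<times> S h;
         X' = dual (U h) \<times> dual (S h);
         \<A> = Maxwell_op \<Omega> (\<T> h) (S h) (U h);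
         T = diag_precond \<Omega> (\<T> h) (S h) (U h) \<circ> \<A>;
         N = product_norm \<Omega> (\<T> h) (S h) (U h)
     in bij_betw (M_v \<Omega> (S h)) (S h) (dual (S h)) \<and>
        bij_betw (A_op \<Omega> (\<T> h) (S h) (U h)) (U h) (dual (U h)) \<and>
        bij_betw \<A> X X' \<and>
        bij_betw T X X \<and>
        (\<forall>x\<in>X. N (T x) \<le> c1 * N x) \<and>
        (\<forall>x\<in>X. N (inv_into X T x) \<le> c2 * N x) \<and>
        condition_number X N T \<le> \<kappa>)"
proof (rule exI[of _ 2], rule conjI, simp, rule exI[of _ 3], rule conjI, simp,
    rule exI[of _ 6], rule conjI, simp, rule ballI)
  fix h assume h: "h \<in> H"
  interpret regularized_saddle "S h" "L2_inner \<Omega>" "U h" "L2_inner \<Omega>"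
    "\<lambda>u v. L2_inner \<Omega> (curl_h (\<T> h) u) (curl_h (\<T> h) v)" "grad_h (\<T> h)"
    by (rule discrete_Maxwell_saddle[OF domain mesh[OF h] S[OF h] U[OF h] V[OF h] exact[OF h]])
  \<comment> \<open>The concrete operators are those of the locale at all arguments, also outside the spaces.\<close>
  have M: "M_v \<Omega> (S h) = mass"
    by (simp add: fun_eq_iff M_v_def mass_def)
  have B: "B_op \<Omega> (\<T> h) (S h) = constraint"
    by (simp add: fun_eq_iff B_op_def constraint_def)
  have A: "A_op \<Omega> (\<T> h) (S h) (U h) = stiffness"
    by (simp add: fun_eq_iff A_op_def CMC_def BT_op_def stiffness_def a_def G_def M B restrict_def)
  have saddle: "Maxwell_op \<Omega> (\<T> h) (S h) (U h) = saddle"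
    by (simp add: fun_eq_iff Maxwell_op_def saddle_def A B BT_op_def stiffness_def restrict_def)
  have precond: "diag_precond \<Omega> (\<T> h) (S h) (U h) = precond"
    by (simp add: fun_eq_iff diag_precond_def precond_def A M)
  have N: "product_norm \<Omega> (\<T> h) (S h) (U h) = N"
    by (simp add: fun_eq_iff product_norm_def N_def A M)
  show "let X = U h \<times> S h;
         X' = dual (U h) \<times> dual (S h);
         \<A> = Maxwell_op \<Omega> (\<T> h) (S h) (U h);
         T = diag_precond \<Omega> (\<T> h) (S h) (U h) \<circ> \<A>;
         N = product_norm \<Omega> (\<T> h) (S h) (U h)
     in bij_betw (M_v \<Omega> (S h)) (S h) (dual (S h)) \<and>
        bij_betw (A_op \<Omega> (\<T> h) (S h) (U h)) (U h) (dual (U h)) \<and>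
        bij_betw \<A> X X' \<and>
        bij_betw T X X \<and>
        (\<forall>x\<in>X. N (T x) \<le> 2 * N x) \<and>
        (\<forall>x\<in>X. N (inv_into X T x) \<le> 3 * N x) \<and>
        condition_number X N T \<le> 6"
    unfolding Let_def M A saddle precond N
    using mass_bij stiffness_bij saddle_bij uniform_preconditioner by blast
qed

end
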